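(* Let $A\in 2^\omega$. The following are equivalent: (i) $A\in\mathrm{Low}(\mathrm{SR})$, i.e., $\mathrm{SR}^A=\mathrm{SR}$. (ii) For every $A$-computable function $f:\mathbb{N}\to\mathbb{R}^{\geq 0}$ whose sum $\sum_n f(n)$ is finite and computable, there exists a computable function $g:\mathbb{N}\to\mathbb{R}^{\geq 0}$ whose sum $\sum_n g(n)$ is finite and computable and such that $f\leq g$. Moreover, the equivalence also holds if in (ii) the condition that $\sum_n f(n)$ is finite and computable is replaced by the condition that $\sum_n f(n)$ is finite and $A$-computable.
   Context: $f\leq g$ means $f(n)\leq g(n)$ for all $n$. Computability of real-valued functions is meant in the usual sense (uniform approximation of the values $f(n)$ by rationals to any prescribed precision), relativized to $A$ where indicated. $2^\omega$ is Cantor space with uniform measure $\mu$. An $A$-Schnorr test is a non-increasing sequence $(\mathcal{U}_n)_{n\in\mathbb{N}}$ of uniformly $A$-c.e. open subsets of $2^\omega$ with $\mu(\mathcal{U}_n)=2^{-n}$ for all $n$; $\mathrm{SR}^A$ is the set of $X\in 2^\omega$ such that $X\notin\bigcap_n\mathcal{U}_n$ for every $A$-Schnorr test; $\mathrm{SR}$ is the unrelativized class. *)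

theory Defs
  imports "HOL-Probability.Probability"
begin

section \<open>Oracle computability on the natural numbers\<close>

text \<open>Partial recursive functions with a characteristic function as additional basic function.
  Argument tuples are lists; a program applied to a list of unsuitable length is undefined.\<close>

datatype prog =
    Zero
  | Succ
  | Oracle
  | Proj nat
  | Comp prog "prog list"
  | PrimRec prog prog
  | Mu prog

primrec run :: "(nat \<Rightarrow> bool) \<Rightarrow> prog \<Rightarrow> nat list \<Rightarrow> nat option" where
  "run A Zero = (\<lambda>xs. Some 0)"
| "run A Succ = (\<lambda>xs. case xs of [x] \<Rightarrow> Some (Suc x) | _ \<Rightarrow> None)"
| "run A Oracle = (\<lambda>xs. case xs of [x] \<Rightarrow> Some (of_bool (A x)) | _ \<Rightarrow> None)"
| "run A (Proj i) = (\<lambda>xs. if i < length xs then Some (xs ! i) else None)"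
| "run A (Comp p qs) =
    (\<lambda>xs. Option.bind (those (map (\<lambda>r. r xs) (map (run A) qs))) (run A p))"
| "run A (PrimRec p q) =
    (\<lambda>xs. case xs of [] \<Rightarrow> None
       | n # ys \<Rightarrow> rec_nat (run A p ys) (\<lambda>k r. Option.bind r (\<lambda>v. run A q (k # v # ys))) n)"
| "run A (Mu p) =
    (\<lambda>xs. if \<exists>z. run A p (z # xs) = Some 0 \<and> (\<forall>y<z. run A p (y # xs) \<noteq> None)
          then Some (LEAST z. run A p (z # xs) = Some 0) else None)"

definition computable2_in :: "(nat \<Rightarrow> bool) \<Rightarrow> (nat \<Rightarrow> nat \<Rightarrow> nat) \<Rightarrow> bool" where
  "computable2_in A h \<longleftrightarrow> (\<exists>p. \<forall>m n. run A p [m, n] = Some (h m n))"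

text \<open>Unrelativized notions are obtained by taking the empty set as the oracle.\<close>

abbreviation no_oracle :: "nat \<Rightarrow> bool" where
  "no_oracle \<equiv> (\<lambda>_. False)"


section \<open>Computable real-valued functions\<close>

text \<open>The rational approximation of \<open>f n\<close> with error at most \<open>2\<close> to the power \<open>-k\<close> is given as
  \<open>(a - b) / (c + 1)\<close> with natural numbers \<open>a\<close>, \<open>b\<close>, \<open>c\<close> computed from \<open>n\<close> and \<open>k\<close>.\<close>

definition computable_realfun_in :: "(nat \<Rightarrow> bool) \<Rightarrow> (nat \<Rightarrow> real) \<Rightarrow> bool" where
  "computable_realfun_in A f \<longleftrightarrow>
     (\<exists>a b c. computable2_in A a \<and> computable2_in A b \<and> computable2_in A c \<and>
        (\<forall>n k. \<bar>f n - (real (a n k) - real (b n k)) / (real (c n k) + 1)\<bar> \<le> (1/2) ^ k))"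

definition computable_real_in :: "(nat \<Rightarrow> bool) \<Rightarrow> real \<Rightarrow> bool" where
  "computable_real_in A x \<longleftrightarrow> computable_realfun_in A (\<lambda>_. x)"


section \<open>Cantor space, c.e. open sets and Schnorr randomness\<close>

definition cantor_measure :: "(nat \<Rightarrow> bool) measure" where
  "cantor_measure = (\<Pi>\<^sub>M i\<in>UNIV. measure_pmf (bernoulli_pmf (1/2)))"

definition cylinder :: "bool list \<Rightarrow> (nat \<Rightarrow> bool) set" where
  "cylinder \<sigma> = {X. \<forall>i<length \<sigma>. X i = \<sigma> ! i}"

text \<open>The numbering of binary strings: \<open>bin_string n\<close> consists of the binary digits of \<open>n + 1\<close>,
  least significant digit first, without the final (most significant) \<open>1\<close>.\<close>

fun bin_string :: "nat \<Rightarrow> bool list" where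
  "bin_string n = (if n = 0 then [] else odd (n + 1) # bin_string ((n - 1) div 2))"

declare bin_string.simps [simp del]

lemma bij_bin_string: "bij bin_string"
proof -
  define enc :: "bool list \<Rightarrow> nat" where
    "enc = (\<lambda>bs. foldr (\<lambda>b m. if b then 2 * m + 2 else 2 * m + 1) bs 0)"
  have dec_enc: "bin_string (enc bs) = bs" for bs
    by (induction bs) (auto simp: enc_def bin_string.simps[of 0] bin_string.simps[of "Suc _"])
  have enc_dec: "enc (bin_string n) = n" for n
  proof (induction n rule: less_induct)
    case (less n)
    show ?case
    proof (cases "n = 0")
      case True
      then show ?thesis by (simp add: enc_def bin_string.simps[of 0])
    next
      case False
      have "enc (bin_string ((n - 1) div 2)) = (n - 1) div 2"
        using False by (intro less) auto
      moreover have "bin_string n = odd (n + 1) # bin_string ((n - 1) div 2)"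
        using False by (subst bin_string.simps) auto
      ultimately have "enc (bin_string n)
          = (if odd (n + 1) then 2 * ((n - 1) div 2) + 2 else 2 * ((n - 1) div 2) + 1)"
        by (simp add: enc_def)
      also have "\<dots> = n" using False by presburger
      finally show ?thesis .
    qed
  qed
  show ?thesis by (rule o_bij[of enc]) (auto simp: dec_enc enc_dec fun_eq_iff)
qed

text \<open>A uniform enumeration of sets of strings: at stage \<open>t\<close> of the \<open>n\<close>-th enumeration, the value
  \<open>Suc s\<close> enumerates the string with number \<open>s\<close>, and the value \<open>0\<close> enumerates nothing.\<close>

definition uniformly_ce_open_in :: "(nat \<Rightarrow> bool) \<Rightarrow> (nat \<Rightarrow> (nat \<Rightarrow> bool) set) \<Rightarrow> bool" where
  "uniformly_ce_open_in A U \<longleftrightarrow>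
     (\<exists>e. computable2_in A e \<and>
        (\<forall>n. U n = (\<Union>s\<in>{s. \<exists>t. e n t = Suc s}. cylinder (bin_string s))))"

definition schnorr_test_in :: "(nat \<Rightarrow> bool) \<Rightarrow> (nat \<Rightarrow> (nat \<Rightarrow> bool) set) \<Rightarrow> bool" where
  "schnorr_test_in A U \<longleftrightarrow>
     decseq U \<and> uniformly_ce_open_in A U \<and>
     (\<forall>n. measure cantor_measure (U n) = (1/2) ^ n)"

definition SR_in :: "(nat \<Rightarrow> bool) \<Rightarrow> (nat \<Rightarrow> bool) set" where
  "SR_in A = {X. \<forall>U. schnorr_test_in A U \<longrightarrow> X \<notin> (\<Inter>n. U n)}"

definition SR :: "(nat \<Rightarrow> bool) set" where
  "SR = SR_in no_oracle"

definition Low_SR :: "(nat \<Rightarrow> bool) set" where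
  "Low_SR = {A. SR_in A = SR}"

end

theory Submission
  imports Defs
begin

text \<open>The bridge between lowness and domination is that a Schnorr test can be exchanged for a sequence
  of clopen sets whose measures form a series with effectively small tails. It is crossed once in
  each direction.

  From domination to lowness. Given an \<open>A\<close>-Schnorr test, cut each component into disjoint cylinders
  and let \<open>f\<close> give each string the total measure that its cylinder contributes to all components.
  The sum of \<open>f\<close> is the sum of the measures of the components, which is \<open>2\<close> whatever the test is
  (\<open>schnorr_weights\<close>); here the exact values of the measures in the definition of a test are used.
  If \<open>g\<close> dominates \<open>f\<close>, then the cylinders whose strings have \<open>g\<close>-weight
  comparable to their own measure form a computable sequence, their measures have effectively small
  tails, and infinitely many of them contain any given point of the original null set. Such a
  sequence of clopen sets can be packed into a Schnorr test (\<open>ex_schnorr_test\<close>).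

  From lowness to domination. Round \<open>f n\<close> up to a power \<open>2\<^sup>-\<^sup>k\<close> with \<open>k \<le> n\<close> and represent it by
  the clopen set \<open>block n k\<close> of this measure, using for distinct \<open>n\<close> disjoint sets of bits, so that
  the blocks are independent. The blocks of \<open>f\<close> can be packed into an \<open>A\<close>-Schnorr test. If \<open>A\<close> is
  low, a category argument (\<open>low_test_cover\<close>) produces an open set \<open>V\<close> of computable measure below
  \<open>1\<close> which, without using \<open>A\<close>, covers almost all blocks of \<open>f\<close> up to null sets. The dominating
  function is read off from \<open>V\<close>: its value at \<open>n\<close> is the measure of the largest block of \<open>n\<close> which
  is covered up to a small error. Since independent sets with divergent sum of measures cover almost
  everything, these values have a finite sum; and since every clopen approximation of the complement
  of \<open>V\<close> is independent of all later blocks, the same reasoning applied to the approximations bounds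
  the tails effectively (\<open>block_cover_extraction\<close>).

  The first direction applies domination to a function with a computable sum, while the second
  yields domination of all \<open>f\<close> with an \<open>A\<close>-computable sum. A computable sum is \<open>A\<close>-computable, so
  both versions of the condition are equivalent to lowness.\<close>

section \<open>Computable functions of one argument\<close>

text \<open>Functions of several arguments are represented as functions of one argument through the pairing
  bijection. An environment of variables is then a nested pair, and no closure rule has to mention
  an arity.\<close>

definition computable_in :: "(nat \<Rightarrow> bool) \<Rightarrow> (nat \<Rightarrow> nat) \<Rightarrow> bool" where
  "computable_in A f \<longleftrightarrow> (\<exists>p. \<forall>x. run A p [x] = Some (f x))"

definition decidable_in :: "(nat \<Rightarrow> bool) \<Rightarrow> (nat \<Rightarrow> bool) \<Rightarrow> bool" where
  "decidable_in A P \<longleftrightarrow> computable_in A (\<lambda>x. of_bool (P x))"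

abbreviation pair :: "nat \<Rightarrow> nat \<Rightarrow> nat" where
  "pair a b \<equiv> prod_encode (a, b)"

definition pfst :: "nat \<Rightarrow> nat" where "pfst e = fst (prod_decode e)"
definition psnd :: "nat \<Rightarrow> nat" where "psnd e = snd (prod_decode e)"

lemma pfst_pair [simp]: "pfst (pair a b) = a" by (simp add: pfst_def)
lemma psnd_pair [simp]: "psnd (pair a b) = b" by (simp add: psnd_def)
lemma pair_pfst_psnd [simp]: "pair (pfst e) (psnd e) = e" by (simp add: pfst_def psnd_def)

text \<open>Just enough arithmetic to invert the pairing function. The recursion runs over the first argument,
  so the program for subtraction takes the subtrahend first.\<close>

definition prog_add :: prog where "prog_add = PrimRec (Proj 0) (Comp Succ [Proj 1])"
definition prog_pred :: prog where "prog_pred = PrimRec Zero (Proj 0)"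
definition prog_sub :: prog where "prog_sub = PrimRec (Proj 0) (Comp prog_pred [Proj 1])"
definition prog_mult :: prog where "prog_mult = PrimRec Zero (Comp prog_add [Proj 1, Proj 2])"
definition prog_triangle :: prog where
  "prog_triangle = PrimRec Zero (Comp Succ [Comp prog_add [Proj 0, Proj 1]])"
definition prog_pair :: prog where
  "prog_pair = Comp prog_add [Comp prog_triangle [Comp prog_add [Proj 0, Proj 1]], Proj 0]"
definition prog_diag :: prog where
  "prog_diag = Mu (Comp prog_sub [Comp prog_triangle [Comp Succ [Proj 0]], Comp Succ [Proj 1]])"
definition prog_pfst :: prog where
  "prog_pfst = Comp prog_sub [Comp prog_triangle [prog_diag], Proj 0]"
definition prog_psnd :: prog where
  "prog_psnd = Comp prog_sub [prog_pfst, prog_diag]"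

lemma run_add: "run A prog_add [m, n] = Some (m + n)"
  unfolding prog_add_def by (induction m) auto

lemma run_pred: "run A prog_pred [n] = Some (n - 1)"
  unfolding prog_pred_def by (induction n) auto

lemma run_sub: "run A prog_sub [n, m] = Some (m - n)"
  unfolding prog_sub_def by (induction n) (auto simp: run_pred)

lemma run_mult: "run A prog_mult [m, n] = Some (m * n)"
  unfolding prog_mult_def by (induction m) (auto simp: run_add)

lemma run_triangle: "run A prog_triangle [n] = Some (triangle n)"
  unfolding prog_triangle_def by (induction n) (auto simp: run_add)

lemma run_pair: "run A prog_pair [m, n] = Some (pair m n)"
  by (simp add: prog_pair_def run_add run_triangle prod_encode_def)

lemma triangle_mono: "m \<le> n \<Longrightarrow> triangle m \<le> triangle n"
  by (rule lift_Suc_mono_le[of triangle]) auto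

text \<open>A number codes a pair on the diagonal \<open>a + b = z\<close> exactly when it lies between two consecutive
  triangle numbers, so unbounded search for the diagonal inverts the pairing function.\<close>

lemma run_diag: "run A prog_diag [e] = Some (pfst e + psnd e)"
proof -
  define z where "z = pfst e + psnd e"
  have e: "e = triangle z + pfst e"
    using pair_pfst_psnd[of e] unfolding z_def prod_encode_def by simp
  let ?q = "Comp prog_sub [Comp prog_triangle [Comp Succ [Proj 0]], Comp Succ [Proj 1]]"
  have q: "run A ?q [y, e] = Some (Suc e - triangle (Suc y))" for y
    by (simp add: run_triangle run_sub)
  have z0: "Suc e - triangle (Suc z) = 0"
    using e z_def by simp
  have small: "Suc e - triangle (Suc y) \<noteq> 0" if "y < z" for y
    using triangle_mono[of "Suc y" z] that e by linarith
  have "(LEAST y. run A ?q [y, e] = Some 0) = z"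
  proof (rule Least_equality)
    show "run A ?q [z, e] = Some 0" unfolding q using z0 by simp
  next
    fix y assume "run A ?q [y, e] = Some 0"
    then show "z \<le> y" unfolding q using small[of y] by (auto simp del: triangle_Suc simp: not_less[symmetric])
  qed
  moreover have "\<exists>y. run A ?q [y, e] = Some 0 \<and> (\<forall>x<y. run A ?q [x, e] \<noteq> None)"
    unfolding q using z0 by blast
  ultimately show ?thesis
    unfolding prog_diag_def z_def[symmetric] by (simp del: run.simps(5))
qed

lemma run_pfst: "run A prog_pfst [e] = Some (pfst e)"
proof -
  have "e - triangle (pfst e + psnd e) = pfst e"
    using pair_pfst_psnd[of e] unfolding prod_encode_def by (metis add_diff_cancel_left' case_prod_conv)
  then show ?thesis by (simp add: prog_pfst_def run_sub run_triangle run_diag)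
qed

lemma run_psnd: "run A prog_psnd [e] = Some (psnd e)"
  by (simp add: prog_psnd_def run_sub run_pfst run_diag)

text \<open>In the rules for binding operators (sums, bounded quantifiers, unions) the premise for the body
  speaks about a coded pair: its first component is the bound variable and its second component the
  old environment. Repeated introduction with these rules then follows the syntax of a term.\<close>

named_theorems comp_intros "closure rules for computable functions, predicates, reals and clopen sets"

lemma computable_id [comp_intros]: "computable_in A (\<lambda>x. x)"
  unfolding computable_in_def by (rule exI[of _ "Proj 0"]) simp

lemma computable_compose:
  assumes "computable_in A f" "computable_in A g"
  shows "computable_in A (\<lambda>x. f (g x))"
proof -
  obtain p q where "\<forall>x. run A p [x] = Some (f x)" "\<forall>x. run A q [x] = Some (g x)"
    using assms unfolding computable_in_def by blast
  then show ?thesis unfolding computable_in_def by (intro exI[of _ "Comp p [q]"]) simp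
qed

lemma computable_binary:
  assumes "\<And>m n. run A r [m, n] = Some (h m n)"
    and "computable_in A f" "computable_in A g"
  shows "computable_in A (\<lambda>x. h (f x) (g x))"
proof -
  obtain p q where "\<forall>x. run A p [x] = Some (f x)" "\<forall>x. run A q [x] = Some (g x)"
    using assms unfolding computable_in_def by blast
  with assms(1) show ?thesis
    unfolding computable_in_def by (intro exI[of _ "Comp r [p, q]"]) simp
qed

lemma computable_unary:
  assumes "\<And>n. run A r [n] = Some (h n)"
    and "computable_in A f"
  shows "computable_in A (\<lambda>x. h (f x))"
  using computable_compose[of A h f] assms unfolding computable_in_def by blast

lemma computable_const [comp_intros]: "computable_in A (\<lambda>_. c)"
proof (induction c)
  case 0
  show ?case unfolding computable_in_def by (rule exI[of _ Zero]) simp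
next
  case (Suc c)
  have "run A Succ [n] = Some (Suc n)" for n by simp
  from computable_unary[OF this Suc] show ?case .
qed

lemmas computable_Suc [comp_intros] = computable_unary[of _ Succ Suc, simplified]
lemmas computable_pfst [comp_intros] = computable_unary[OF run_pfst]
lemmas computable_psnd [comp_intros] = computable_unary[OF run_psnd]
lemmas computable_pair [comp_intros] = computable_binary[OF run_pair]
lemmas computable_add [comp_intros] = computable_binary[OF run_add]
lemmas computable_mult [comp_intros] = computable_binary[OF run_mult]

lemma computable_diff [comp_intros]:
  "computable_in A f \<Longrightarrow> computable_in A g \<Longrightarrow> computable_in A (\<lambda>x. f x - g x)"
  using computable_binary[OF run_sub, of A g f] by simp

lemma computable_rec_nat:
  assumes g: "computable_in A g" and n: "computable_in A n"
    and h: "computable_in A (\<lambda>z. h (pfst z) (pfst (psnd z)) (psnd (psnd z)))"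
  shows "computable_in A (\<lambda>x. rec_nat (g x) (\<lambda>i r. h i r x) (n x))"
proof -
  obtain pg where pg: "\<And>x. run A pg [x] = Some (g x)" using g unfolding computable_in_def by blast
  obtain ph where ph: "\<And>z. run A ph [z] = Some (h (pfst z) (pfst (psnd z)) (psnd (psnd z)))"
    using h unfolding computable_in_def by blast
  let ?step = "Comp ph [Comp prog_pair [Proj 0, Comp prog_pair [Proj 1, Proj 2]]]"
  have "run A (PrimRec pg ?step) [m, x] = Some (rec_nat (g x) (\<lambda>i r. h i r x) m)" for m x
    by (induction m) (simp_all add: pg ph run_pair)
  from computable_binary[OF this n computable_id] show ?thesis .
qed

lemma computable_sum [comp_intros]:
  assumes f: "computable_in A (\<lambda>z. f (pfst z) (psnd z))" and b: "computable_in A b"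
  shows "computable_in A (\<lambda>x. \<Sum>i<b x. f i x)"
proof -
  have "computable_in A (\<lambda>z. f (pfst (pair (pfst z) (psnd (psnd z)))) (psnd (pair (pfst z) (psnd (psnd z)))))"
    by (rule computable_compose[OF f]) (intro comp_intros)
  then have "computable_in A (\<lambda>z. pfst (psnd z) + f (pfst z) (psnd (psnd z)))"
    by (intro comp_intros) simp
  from computable_rec_nat[OF computable_const[of _ 0] b this]
  have "computable_in A (\<lambda>x. rec_nat 0 (\<lambda>i r. r + f i x) (b x))" .
  moreover have "rec_nat 0 (\<lambda>i r. r + f i x) m = (\<Sum>i<m. f i x)" for x m
    by (induction m) auto
  ultimately show ?thesis by simp
qed

lemma computable_power [comp_intros]:
  assumes f: "computable_in A f" and b: "computable_in A b"
  shows "computable_in A (\<lambda>x. f x ^ b x)"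
proof -
  have "computable_in A (\<lambda>z. pfst (psnd z) * f (psnd (psnd z)))"
    by (intro comp_intros computable_compose[OF f])
  from computable_rec_nat[OF computable_const[of _ 1] b this]
  have "computable_in A (\<lambda>x. rec_nat 1 (\<lambda>i r. r * f x) (b x))" .
  moreover have "rec_nat 1 (\<lambda>i r. r * f x) m = f x ^ m" for x m
    by (induction m) auto
  ultimately show ?thesis by simp
qed

lemma computable_of_bool [comp_intros]:
  "decidable_in A P \<Longrightarrow> computable_in A (\<lambda>x. of_bool (P x))"
  by (simp add: decidable_in_def)

lemma decidable_compose:
  "decidable_in A P \<Longrightarrow> computable_in A f \<Longrightarrow> decidable_in A (\<lambda>x. P (f x))"
  unfolding decidable_in_def by (rule computable_compose)

lemma decidable_const [comp_intros]: "decidable_in A (\<lambda>_. c)"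
  unfolding decidable_in_def by (intro comp_intros)

lemma decidable_le [comp_intros]:
  assumes "computable_in A f" "computable_in A g"
  shows "decidable_in A (\<lambda>x. f x \<le> g x)"
proof -
  have "computable_in A (\<lambda>x. 1 - (f x - g x))" using assms by (intro comp_intros)
  moreover have "1 - (f x - g x) = of_bool (f x \<le> g x)" for x by auto
  ultimately show ?thesis unfolding decidable_in_def by simp
qed

lemma decidable_not [comp_intros]:
  assumes "decidable_in A P"
  shows "decidable_in A (\<lambda>x. \<not> P x)"
proof -
  have "computable_in A (\<lambda>x. 1 - of_bool (P x))" using assms by (intro comp_intros)
  moreover have "1 - of_bool (P x) = (of_bool (\<not> P x) :: nat)" for x by auto
  ultimately show ?thesis unfolding decidable_in_def by simp
qed

lemma decidable_conj [comp_intros]: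
  assumes "decidable_in A P" "decidable_in A Q"
  shows "decidable_in A (\<lambda>x. P x \<and> Q x)"
proof -
  have "computable_in A (\<lambda>x. of_bool (P x) * of_bool (Q x))" using assms by (intro comp_intros)
  moreover have "of_bool (P x) * of_bool (Q x) = (of_bool (P x \<and> Q x) :: nat)" for x by auto
  ultimately show ?thesis unfolding decidable_in_def by simp
qed

lemma decidable_disj [comp_intros]:
  assumes "decidable_in A P" "decidable_in A Q"
  shows "decidable_in A (\<lambda>x. P x \<or> Q x)"
proof -
  have "decidable_in A (\<lambda>x. \<not> (\<not> P x \<and> \<not> Q x))" using assms by (intro comp_intros)
  then show ?thesis by simp
qed

lemma decidable_iff [comp_intros]:
  assumes "decidable_in A P" "decidable_in A Q"
  shows "decidable_in A (\<lambda>x. P x \<longleftrightarrow> Q x)"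
proof -
  have "decidable_in A (\<lambda>x. (P x \<and> Q x) \<or> (\<not> P x \<and> \<not> Q x))" using assms by (intro comp_intros)
  moreover have "((P x \<and> Q x) \<or> (\<not> P x \<and> \<not> Q x)) = (P x \<longleftrightarrow> Q x)" for x by auto
  ultimately show ?thesis by simp
qed

lemma decidable_less [comp_intros]:
  assumes "computable_in A f" "computable_in A g"
  shows "decidable_in A (\<lambda>x. f x < g x)"
proof -
  have "decidable_in A (\<lambda>x. Suc (f x) \<le> g x)" using assms by (intro comp_intros)
  then show ?thesis by (simp add: Suc_le_eq)
qed

lemma decidable_eq [comp_intros]:
  assumes "computable_in A f" "computable_in A g"
  shows "decidable_in A (\<lambda>x. f x = g x)"
proof -
  have "decidable_in A (\<lambda>x. f x \<le> g x \<and> g x \<le> f x)" using assms by (intro comp_intros)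
  moreover have "(f x \<le> g x \<and> g x \<le> f x) = (f x = g x)" for x by auto
  ultimately show ?thesis by simp
qed

lemma decidable_Bex [comp_intros]:
  assumes "decidable_in A (\<lambda>z. P (pfst z) (psnd z))" "computable_in A b"
  shows "decidable_in A (\<lambda>x. \<exists>i<b x. P i x)"
proof -
  have "decidable_in A (\<lambda>x. 0 < (\<Sum>i<b x. of_bool (P i x) :: nat))"
    using assms by (intro comp_intros)
  moreover have "0 < (\<Sum>i<b x. of_bool (P i x) :: nat) \<longleftrightarrow> (\<exists>i<b x. P i x)" for x
    by (auto simp: sum_pos2 simp flip: neq0_conv)
  ultimately show ?thesis by simp
qed

lemma decidable_Ball [comp_intros]:
  assumes "decidable_in A (\<lambda>z. P (pfst z) (psnd z))" "computable_in A b"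
  shows "decidable_in A (\<lambda>x. \<forall>i<b x. P i x)"
proof -
  have "decidable_in A (\<lambda>x. \<not> (\<exists>i<b x. \<not> P i x))"
    using assms by (intro comp_intros)
  then show ?thesis by simp
qed

lemma computable_if [comp_intros]:
  assumes "decidable_in A P" "computable_in A f" "computable_in A g"
  shows "computable_in A (\<lambda>x. if P x then f x else g x)"
proof -
  have "computable_in A (\<lambda>x. of_bool (P x) * f x + of_bool (\<not> P x) * g x)"
    using assms by (intro comp_intros)
  moreover have "of_bool (P x) * f x + of_bool (\<not> P x) * g x = (if P x then f x else g x)" for x
    by auto
  ultimately show ?thesis by simp
qed

lemma computable_Least:
  assumes P: "decidable_in A (\<lambda>z. P (pfst z) (psnd z))" and ex: "\<And>x. \<exists>z. P z x"
  shows "computable_in A (\<lambda>x. LEAST z. P z x)"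
proof -
  have "computable_in A (\<lambda>z. of_bool (\<not> P (pfst z) (psnd z)))"
    using P by (intro comp_intros)
  then obtain r where r: "\<And>z. run A r [z] = Some (of_bool (\<not> P (pfst z) (psnd z)))"
    unfolding computable_in_def by blast
  let ?q = "Comp r [prog_pair]"
  have q: "run A ?q [z, x] = Some (of_bool (\<not> P z x))" for z x
    by (simp add: run_pair r)
  have "run A (Mu ?q) [x] = Some (LEAST z. P z x)" for x
    using ex[of x] by (simp add: q del: run.simps(5))
  then show ?thesis unfolding computable_in_def by blast
qed

lemma computable_div [comp_intros]:
  assumes f: "computable_in A f" and g: "computable_in A g"
  shows "computable_in A (\<lambda>x. f x div g x)"
proof -
  have "computable_in A (\<lambda>x. LEAST z. g x = 0 \<or> f x < Suc z * g x)"
  proof (rule computable_Least)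
    show "decidable_in A (\<lambda>z. g (psnd z) = 0 \<or> f (psnd z) < Suc (pfst z) * g (psnd z))"
      by (intro comp_intros computable_compose[OF f] computable_compose[OF g])
    show "\<exists>z. g x = 0 \<or> f x < Suc z * g x" for x
      by (metis less_Suc_eq_le mult_le_mono2 mult_1_right not_gr_zero less_eq_Suc_le One_nat_def
          order_less_le_trans lessI)
  qed
  (* The disjunct for b = 0 makes the search total and agrees with division by zero. *)
  moreover have "(LEAST z. b = 0 \<or> a < Suc z * b) = a div b" for a b :: nat
  proof (cases "b = 0")
    case True then show ?thesis by (simp add: Least_eq_0)
  next
    case False
    then show ?thesis
    proof (intro Least_equality)
      show "b = 0 \<or> a < Suc (a div b) * b"
        using False by (metis dividend_less_div_times mult_Suc add.commute bot_nat_0.not_eq_extremum)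
      fix y assume "b = 0 \<or> a < Suc y * b"
      then show "a div b \<le> y" using False by (simp add: less_mult_imp_div_less flip: less_Suc_eq_le)
    qed
  qed
  ultimately show ?thesis by simp
qed

lemma decidable_odd [comp_intros]:
  assumes "computable_in A f"
  shows "decidable_in A (\<lambda>x. odd (f x))"
proof -
  have "decidable_in A (\<lambda>x. f x div 2 * 2 < f x)" using assms by (intro comp_intros)
  moreover have "n div 2 * 2 < n \<longleftrightarrow> odd n" for n :: nat by presburger
  ultimately show ?thesis by simp
qed

lemma computable2_iff: "computable2_in A h \<longleftrightarrow> computable_in A (\<lambda>z. h (pfst z) (psnd z))"
proof
  assume "computable2_in A h"
  then obtain r where "\<And>m n. run A r [m, n] = Some (h m n)" unfolding computable2_in_def by blast
  from computable_binary[OF this computable_pfst[OF computable_id] computable_psnd[OF computable_id]]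
  show "computable_in A (\<lambda>z. h (pfst z) (psnd z))" .
next
  assume "computable_in A (\<lambda>z. h (pfst z) (psnd z))"
  then obtain r where r: "\<And>z. run A r [z] = Some (h (pfst z) (psnd z))"
    unfolding computable_in_def by blast
  then show "computable2_in A h"
    unfolding computable2_in_def by (intro exI[of _ "Comp r [prog_pair]"]) (simp add: run_pair)
qed

text \<open>Unrelativized computations use the empty oracle. Answering every oracle query by \<open>0\<close> turns them
  into computations relative to an arbitrary oracle.\<close>

primrec forget_oracle :: "prog \<Rightarrow> prog" where
  "forget_oracle Zero = Zero"
| "forget_oracle Succ = Succ"
| "forget_oracle Oracle = Zero"
| "forget_oracle (Proj i) = Proj i"
| "forget_oracle (Comp p qs) = Comp (forget_oracle p) (map forget_oracle qs)"
| "forget_oracle (PrimRec p q) = PrimRec (forget_oracle p) (forget_oracle q)"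
| "forget_oracle (Mu p) = Mu (forget_oracle p)"

lemma those_eq_Some_iff: "those xs = Some ys \<longleftrightarrow> xs = map Some ys"
proof (induction xs arbitrary: ys)
  case (Cons x xs)
  then show ?case by (cases x; cases ys) auto
qed auto

text \<open>The translated program may be defined on more arguments than the original, because \<open>Zero\<close>
  accepts lists of every length while \<open>Oracle\<close> does not; hence only an implication.\<close>

lemma run_forget_oracle:
  "run no_oracle p xs = Some v \<Longrightarrow> run A (forget_oracle p) xs = Some v"
proof (induction p arbitrary: xs v)
  case Oracle
  then show ?case by (auto split: list.splits)
next
  case (Comp p qs)
  then obtain ys where ys: "map (\<lambda>q. run no_oracle q xs) qs = map Some ys"
    and v: "run no_oracle p ys = Some v"
    by (auto simp: Option.bind_eq_Some_conv those_eq_Some_iff comp_def)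
  have "map (\<lambda>q. run A (forget_oracle q) xs) qs = map Some ys"
  proof (rule nth_equalityI)
    show "length (map (\<lambda>q. run A (forget_oracle q) xs) qs) = length (map Some ys)"
      using ys by (metis length_map)
    fix i assume "i < length (map (\<lambda>q. run A (forget_oracle q) xs) qs)"
    then have i: "i < length qs" "i < length ys" using ys by (auto dest: map_eq_imp_length_eq)
    then have "run no_oracle (qs ! i) xs = Some (ys ! i)" using ys by (metis nth_map)
    then have "run A (forget_oracle (qs ! i)) xs = Some (ys ! i)" using Comp.IH(2) i by auto
    then show "map (\<lambda>q. run A (forget_oracle q) xs) qs ! i = map Some ys ! i" using i by simp
  qed
  with Comp.IH(1)[OF v] show ?case
    by (auto simp: Option.bind_eq_Some_conv those_eq_Some_iff comp_def)
next
  case (PrimRec p q)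
  then obtain n ys where xs: "xs = n # ys" by (auto split: list.splits)
  have "rec_nat (run no_oracle p ys) (\<lambda>k r. Option.bind r (\<lambda>v. run no_oracle q (k # v # ys))) n = Some w
    \<Longrightarrow> rec_nat (run A (forget_oracle p) ys)
          (\<lambda>k r. Option.bind r (\<lambda>v. run A (forget_oracle q) (k # v # ys))) n = Some w" for w
    using PrimRec.IH by (induction n arbitrary: w) (auto simp: Option.bind_eq_Some_conv)
  then show ?case using PrimRec.prems xs by simp
next
  case (Mu p)
  let ?r = "\<lambda>z. run no_oracle p (z # xs)" and ?s = "\<lambda>z. run A (forget_oracle p) (z # xs)"
  from Mu.prems obtain z where z: "?r z = Some 0" "\<forall>y<z. ?r y \<noteq> None"
    and v: "v = (LEAST z. ?r z = Some 0)"
    by (auto split: if_splits)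
  have v0: "?r v = Some 0" unfolding v using z(1) by (rule LeastI)
  have "v \<le> z" unfolding v using z(1) by (rule Least_le)
  have *: "\<exists>w. ?r y = Some w \<and> ?s y = Some w \<and> w \<noteq> 0" if "y < v" for y
  proof -
    have "?r y \<noteq> None" using z(2) \<open>v \<le> z\<close> that by simp
    then obtain w where w: "?r y = Some w" by blast
    moreover have "w \<noteq> 0" using not_less_Least[of y "\<lambda>z. ?r z = Some 0"] that w v by auto
    ultimately show ?thesis using Mu.IH by blast
  qed
  have s: "?s v = Some 0" using Mu.IH v0 by blast
  have "(LEAST z. ?s z = Some 0) = v"
  proof (rule Least_equality)
    show "?s v = Some 0" by (rule s)
    fix y assume "?s y = Some 0"
    then show "v \<le> y" using *[of y] by (cases "y < v") auto
  qed
  moreover have "\<exists>z. ?s z = Some 0 \<and> (\<forall>y<z. ?s y \<noteq> None)" using s * by fastforce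
  ultimately show ?case by simp
qed (auto split: list.splits if_splits)

lemma computable2_no_oracle: "computable2_in no_oracle h \<Longrightarrow> computable2_in A h"
  unfolding computable2_in_def using run_forget_oracle by metis

lemma computable_realfun_no_oracle:
  "computable_realfun_in no_oracle f \<Longrightarrow> computable_realfun_in A f"
  unfolding computable_realfun_in_def using computable2_no_oracle by metis

lemma schnorr_test_no_oracle: "schnorr_test_in no_oracle U \<Longrightarrow> schnorr_test_in A U"
  unfolding schnorr_test_in_def uniformly_ce_open_in_def using computable2_no_oracle by metis

section \<open>Computable sequences of dyadic rationals\<close>

text \<open>All numerical tests below compare measures of clopen sets, powers of \<open>1/2\<close> and rational
  approximations. As these are dyadic rationals, the tests can be carried out exactly; comparison
  of computable reals, which is undecidable, never occurs.\<close>

definition dyadic_in :: "(nat \<Rightarrow> bool) \<Rightarrow> (nat \<Rightarrow> real) \<Rightarrow> bool" where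
  "dyadic_in A f \<longleftrightarrow> (\<exists>a l. computable_in A a \<and> computable_in A l \<and> (\<forall>e. f e = real (a e) / 2 ^ l e))"

lemma dyadicI:
  "computable_in A a \<Longrightarrow> computable_in A l \<Longrightarrow> (\<And>e. f e = real (a e) / 2 ^ l e) \<Longrightarrow> dyadic_in A f"
  unfolding dyadic_in_def by blast

lemma dyadic_nonneg: "dyadic_in A f \<Longrightarrow> 0 \<le> f e"
  by (auto simp: dyadic_in_def)

lemma dyadic_compose:
  assumes "dyadic_in A f" "computable_in A h"
  shows "dyadic_in A (\<lambda>e. f (h e))"
proof -
  obtain a l where al: "computable_in A a" "computable_in A l" "\<And>e. f e = real (a e) / 2 ^ l e"
    using assms(1) unfolding dyadic_in_def by blast
  show ?thesis
    by (rule dyadicI[OF computable_compose[OF al(1) assms(2)] computable_compose[OF al(2) assms(2)]])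
      (simp add: al(3))
qed

lemma dyadic_of_nat [comp_intros]:
  assumes "computable_in A a"
  shows "dyadic_in A (\<lambda>e. real (a e))"
  by (rule dyadicI[of A a "\<lambda>_. 0"]) (intro comp_intros assms | simp)+

lemma dyadic_half_power [comp_intros]:
  assumes "computable_in A l"
  shows "dyadic_in A (\<lambda>e. (1/2) ^ l e)"
  by (rule dyadicI[of A "\<lambda>_. 1" l]) (intro comp_intros assms | simp add: power_divide)+

lemma dyadic_add [comp_intros]:
  assumes "dyadic_in A f" "dyadic_in A g"
  shows "dyadic_in A (\<lambda>e. f e + g e)"
proof -
  obtain a l where al: "computable_in A a" "computable_in A l" "\<And>e. f e = real (a e) / 2 ^ l e"
    using assms(1) unfolding dyadic_in_def by blast
  obtain b m where bm: "computable_in A b" "computable_in A m" "\<And>e. g e = real (b e) / 2 ^ m e"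
    using assms(2) unfolding dyadic_in_def by blast
  show ?thesis
  proof (rule dyadicI)
    show "computable_in A (\<lambda>e. a e * 2 ^ m e + b e * 2 ^ l e)" "computable_in A (\<lambda>e. l e + m e)"
      using al bm by (intro comp_intros; simp)+
  qed (simp add: al(3) bm(3) field_simps power_add)
qed

lemma dyadic_mult [comp_intros]:
  assumes "dyadic_in A f" "dyadic_in A g"
  shows "dyadic_in A (\<lambda>e. f e * g e)"
proof -
  obtain a l where al: "computable_in A a" "computable_in A l" "\<And>e. f e = real (a e) / 2 ^ l e"
    using assms(1) unfolding dyadic_in_def by blast
  obtain b m where bm: "computable_in A b" "computable_in A m" "\<And>e. g e = real (b e) / 2 ^ m e"
    using assms(2) unfolding dyadic_in_def by blast
  show ?thesis
  proof (rule dyadicI)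
    show "computable_in A (\<lambda>e. a e * b e)" "computable_in A (\<lambda>e. l e + m e)"
      using al bm by (intro comp_intros; simp)+
  qed (simp add: al(3) bm(3) field_simps power_add)
qed

lemma dyadic_sum [comp_intros]:
  assumes f: "dyadic_in A (\<lambda>z. f (pfst z) (psnd z))" and b: "computable_in A b"
  shows "dyadic_in A (\<lambda>e. \<Sum>i<b e. f i e)"
proof -
  obtain a l where al: "computable_in A a" "computable_in A l"
    "\<And>z. f (pfst z) (psnd z) = real (a z) / 2 ^ l z"
    using f unfolding dyadic_in_def by blast
  have f_eq: "f i e = real (a (pair i e)) / 2 ^ l (pair i e)" for i e
    using al(3)[of "pair i e"] by simp
  (* The sum of the exponents serves as a common exponent of the denominators. *)
  define m where "m = (\<lambda>e. \<Sum>i<b e. l (pair i e))"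
  have m: "computable_in A m"
    unfolding m_def by (intro comp_intros b computable_compose[OF al(2)])
  show ?thesis
  proof (rule dyadicI[OF _ m])
    show "computable_in A (\<lambda>e. \<Sum>i<b e. a (pair i e) * 2 ^ (m e - l (pair i e)))"
      by (intro comp_intros b computable_compose[OF al(1)] computable_compose[OF al(2)]
          computable_compose[OF m])
    fix e
    have "f i e = real (a (pair i e) * 2 ^ (m e - l (pair i e))) / 2 ^ m e" if "i < b e" for i
    proof -
      have "l (pair i e) \<le> m e"
        unfolding m_def using that by (intro member_le_sum) auto
      then have "(2::real) ^ m e = 2 ^ (m e - l (pair i e)) * 2 ^ l (pair i e)"
        by (simp flip: power_add)
      then show ?thesis by (simp add: f_eq)
    qed
    then show "(\<Sum>i<b e. f i e) = real (\<Sum>i<b e. a (pair i e) * 2 ^ (m e - l (pair i e))) / 2 ^ m e"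
      by (simp add: sum_divide_distrib)
  qed
qed

lemma dyadic_if [comp_intros]:
  assumes "decidable_in A P" "dyadic_in A f" "dyadic_in A g"
  shows "dyadic_in A (\<lambda>e. if P e then f e else g e)"
proof -
  have "dyadic_in A (\<lambda>e. real (of_bool (P e)) * f e + real (of_bool (\<not> P e)) * g e)"
    using assms by (intro comp_intros)
  moreover have "real (of_bool (P e)) * f e + real (of_bool (\<not> P e)) * g e = (if P e then f e else g e)" for e
    by auto
  ultimately show ?thesis by simp
qed

lemma decidable_dyadic_le [comp_intros]:
  assumes "dyadic_in A f" "dyadic_in A g"
  shows "decidable_in A (\<lambda>e. f e \<le> g e)"
proof -
  obtain a l where al: "computable_in A a" "computable_in A l" "\<And>e. f e = real (a e) / 2 ^ l e"
    using assms(1) unfolding dyadic_in_def by blast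
  obtain b m where bm: "computable_in A b" "computable_in A m" "\<And>e. g e = real (b e) / 2 ^ m e"
    using assms(2) unfolding dyadic_in_def by blast
  have "decidable_in A (\<lambda>e. a e * 2 ^ m e \<le> b e * 2 ^ l e)"
    using al bm by (intro comp_intros)
  moreover have "f e \<le> g e \<longleftrightarrow> a e * 2 ^ m e \<le> b e * 2 ^ l e" for e
  proof -
    have "f e \<le> g e \<longleftrightarrow> real (a e * 2 ^ m e) \<le> real (b e * 2 ^ l e)"
      by (simp add: al(3) bm(3) field_simps)
    then show ?thesis by (simp only: of_nat_le_iff)
  qed
  ultimately show ?thesis by simp
qed

section \<open>Binary strings\<close>

lemma decidable_bit [comp_intros]:
  assumes "computable_in A f" "computable_in A g"
  shows "decidable_in A (\<lambda>x. bit (f x) (g x))"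
  unfolding bit_iff_odd using assms by (intro comp_intros)

abbreviation len :: "nat \<Rightarrow> nat" where
  "len u \<equiv> length (bin_string u)"

text \<open>The string numbered \<open>u\<close> is the binary expansion of \<open>Suc u\<close> without its leading digit. Hence
  lengths are logarithms of \<open>Suc u\<close>, and entries are its bits.\<close>

lemma len_bounds: "2 ^ len u \<le> Suc u \<and> Suc u < 2 ^ Suc (len u)"
proof (induction u rule: bin_string.induct)
  case (1 u)
  show ?case
  proof (cases "u = 0")
    case True then show ?thesis by (simp add: bin_string.simps[of 0])
  next
    case False
    then have "len u = Suc (len ((u - 1) div 2))" by (subst bin_string.simps) simp
    moreover have "2 ^ len ((u - 1) div 2) \<le> Suc ((u - 1) div 2)"
      "Suc ((u - 1) div 2) < 2 ^ Suc (len ((u - 1) div 2))"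
      using 1[OF False] by auto
    ultimately show ?thesis using False by simp linarith
  qed
qed

lemma nth_bin_string: "i < len u \<Longrightarrow> bin_string u ! i = bit (Suc u) i"
proof (induction u arbitrary: i rule: bin_string.induct)
  case (1 u)
  show ?case
  proof (cases "u = 0")
    case True with 1 show ?thesis by (simp add: bin_string.simps[of 0])
  next
    case False
    have u: "bin_string u = odd (u + 1) # bin_string ((u - 1) div 2)"
      using False by (subst bin_string.simps) simp
    have half: "Suc ((u - 1) div 2) = Suc u div 2" using False by presburger
    show ?thesis
    proof (cases i)
      case 0 then show ?thesis by (simp add: u bit_0)
    next
      case (Suc j)
      then have "bin_string ((u - 1) div 2) ! j = bit (Suc ((u - 1) div 2)) j"
        using 1 False u by simp
      then show ?thesis unfolding half by (simp add: u Suc bit_Suc)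
    qed
  qed
qed

lemma cylinder_bin_string: "cylinder (bin_string u) = {X. \<forall>i<len u. X i = bit (Suc u) i}"
  by (auto simp: cylinder_def nth_bin_string)

lemma ex_bin_string_cylinder: "\<exists>u. len u = l \<and> X \<in> cylinder (bin_string u)"
proof -
  obtain u where "bin_string u = map X [0..<l]"
    using bij_bin_string by (metis bij_pointE)
  then show ?thesis by (intro exI[of _ u]) (simp add: cylinder_def)
qed

lemma bin_string_cylinder_unique:
  assumes "X \<in> cylinder (bin_string u)" "X \<in> cylinder (bin_string v)" "len u = len v"
  shows "u = v"
proof -
  have "bin_string u = bin_string v"
    using assms by (auto simp: cylinder_def intro!: nth_equalityI)
  then show ?thesis using bij_bin_string by (metis bij_pointE)
qed

lemma computable_len [comp_intros]:
  assumes "computable_in A h"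
  shows "computable_in A (\<lambda>e. len (h e))"
proof -
  have "computable_in A (\<lambda>u. LEAST k. Suc u < 2 ^ Suc k)"
  proof (rule computable_Least)
    show "decidable_in A (\<lambda>z. Suc (psnd z) < 2 ^ Suc (pfst z))" by (intro comp_intros)
    show "\<exists>k. Suc u < 2 ^ Suc k" for u using len_bounds by blast
  qed
  moreover have "(LEAST k. Suc u < 2 ^ Suc k) = len u" for u
  proof (rule Least_equality)
    show "Suc u < 2 ^ Suc (len u)" using len_bounds by blast
    fix k assume "Suc u < 2 ^ Suc k"
    then have "2 ^ len u < (2 :: nat) ^ Suc k" using len_bounds[of u] by linarith
    then show "len u \<le> k" by (simp add: less_Suc_eq_le del: power_Suc)
  qed
  ultimately have "computable_in A len" by simp
  from computable_compose[OF this assms] show ?thesis .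
qed

section \<open>Measure on Cantor space\<close>

definition depends_below :: "nat \<Rightarrow> (nat \<Rightarrow> bool) set \<Rightarrow> bool" where
  "depends_below l C \<longleftrightarrow> (\<forall>X Y. (\<forall>i<l. X i = Y i) \<longrightarrow> X \<in> C \<longrightarrow> Y \<in> C)"

lemma depends_belowD: "depends_below l C \<Longrightarrow> (\<And>i. i < l \<Longrightarrow> X i = Y i) \<Longrightarrow> X \<in> C \<longleftrightarrow> Y \<in> C"
  unfolding depends_below_def by metis

lemma depends_below_mono: "depends_below l C \<Longrightarrow> l \<le> m \<Longrightarrow> depends_below m C"
  unfolding depends_below_def using order_less_le_trans by blast

interpretation cantor: prob_space cantor_measure
  unfolding cantor_measure_def by (rule prob_space_PiM) (rule measure_pmf.prob_space_axioms)

abbreviation \<mu> :: "(nat \<Rightarrow> bool) set \<Rightarrow> real" where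
  "\<mu> \<equiv> measure cantor_measure"

lemma space_cantor [simp]: "space cantor_measure = UNIV"
  by (simp add: cantor_measure_def space_PiM)

lemma box_measure:
  assumes "finite J"
  shows "{X. \<forall>i\<in>J. X i = Z i} \<in> sets cantor_measure"
    and "\<mu> {X. \<forall>i\<in>J. X i = Z i} = (1/2) ^ card J"
proof -
  interpret product_prob_space "\<lambda>_::nat. measure_pmf (bernoulli_pmf (1/2))" UNIV
    by unfold_locales
  have "emeasure cantor_measure {X \<in> space cantor_measure. \<forall>i\<in>J. X i \<in> {Z i}}
      = (\<Prod>i\<in>J. emeasure (measure_pmf (bernoulli_pmf (1/2))) {Z i})"
    unfolding cantor_measure_def using assms by (intro emeasure_PiM_Collect) auto
  moreover have "emeasure (measure_pmf (bernoulli_pmf (1/2))) {b} = ennreal (1/2)" for b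
    by (cases b) (auto simp: emeasure_pmf_single)
  ultimately have "emeasure cantor_measure {X. \<forall>i\<in>J. X i = Z i} = ennreal ((1/2) ^ card J)"
    by (simp add: prod_ennreal ennreal_power del: ennreal_half)
  then show "\<mu> {X. \<forall>i\<in>J. X i = Z i} = (1/2) ^ card J"
    by (simp add: measure_def)
  show "{X. \<forall>i\<in>J. X i = Z i} \<in> sets cantor_measure"
    by (rule emeasure_neq_0_sets) (simp add: \<open>emeasure cantor_measure {X. \<forall>i\<in>J. X i = Z i} = _\<close>)
qed

lemma ex_bits: "\<exists>s<2 ^ l. \<forall>i<l. bit (s :: nat) i = X i"
proof (intro exI conjI allI impI)
  show "horner_sum of_bool 2 (map X [0..<l]) < (2 :: nat) ^ l"
    using horner_sum_bound[of "map X [0..<l]"] by simp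
  show "bit (horner_sum of_bool 2 (map X [0..<l]) :: nat) i = X i" if "i < l" for i
    using that by (simp add: bit_horner_sum_bit_iff)
qed

lemma bits_unique:
  fixes s t :: nat
  assumes "s < 2 ^ l" "t < 2 ^ l" "\<And>i. i < l \<Longrightarrow> bit s i = bit t i"
  shows "s = t"
proof -
  have "take_bit l s = take_bit l t"
    using assms(3) by (auto intro!: bit_eqI simp: bit_take_bit_iff)
  then show ?thesis using assms(1,2) by (simp add: take_bit_nat_eq_self)
qed

text \<open>A set determined by its first \<open>l\<close> bits is a disjoint union of boxes of measure \<open>2\<close> to the
  power \<open>-l\<close>; intersecting it with a condition on bits in a set \<open>J\<close> beyond \<open>l\<close> only refines these
  boxes. The case of empty \<open>J\<close> computes the measure, the general case is independence.\<close>

lemma measure_depends_below_Int: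
  assumes C: "depends_below l C" and J: "finite J" "\<And>i. i \<in> J \<Longrightarrow> l \<le> i"
  shows "C \<inter> {X. \<forall>i\<in>J. X i} \<in> sets cantor_measure"
    and "\<mu> (C \<inter> {X. \<forall>i\<in>J. X i}) = (\<Sum>s<(2::nat) ^ l. of_bool (bit s \<in> C)) / 2 ^ l * (1/2) ^ card J"
proof -
  define S where "S = {s::nat. s < 2 ^ l \<and> bit s \<in> C}"
  define B where "B = (\<lambda>s::nat. {X. \<forall>i\<in>{..<l} \<union> J. X i = (if i < l then bit s i else True)})"
  have fin: "finite S" unfolding S_def by simp
  have disj: "card ({..<l} \<union> J) = l + card J"
    using J by (subst card_Un_disjoint) (auto simp: not_less[symmetric])
  have B: "B s \<in> sets cantor_measure" "\<mu> (B s) = (1/2) ^ (l + card J)" for s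
    unfolding B_def using J by (simp_all only: box_measure disj finite_Un finite_lessThan)
  have in_B: "X \<in> B s \<longleftrightarrow> (\<forall>i<l. X i = bit s i) \<and> (\<forall>i\<in>J. X i)" for X s
    unfolding B_def using J(2) by (auto simp: not_less[symmetric])
  have eq: "C \<inter> {X. \<forall>i\<in>J. X i} = (\<Union>s\<in>S. B s)"
  proof (intro set_eqI iffI)
    fix X assume X: "X \<in> C \<inter> {X. \<forall>i\<in>J. X i}"
    obtain s :: nat where s: "s < 2 ^ l" "\<forall>i<l. bit s i = X i" using ex_bits[of l X] by blast
    moreover have "bit s \<in> C" using depends_belowD[OF C, of "bit s" X] s X by auto
    ultimately show "X \<in> (\<Union>s\<in>S. B s)" using X by (auto simp: S_def in_B)
  next
    fix X assume "X \<in> (\<Union>s\<in>S. B s)"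
    then obtain s where "s \<in> S" "X \<in> B s" by blast
    then have "bit s \<in> C" "\<forall>i<l. X i = bit s i" "\<forall>i\<in>J. X i"
      unfolding S_def in_B by blast+
    then show "X \<in> C \<inter> {X. \<forall>i\<in>J. X i}"
      using depends_belowD[OF C, of "bit s" X] by auto
  qed
  show "C \<inter> {X. \<forall>i\<in>J. X i} \<in> sets cantor_measure"
    unfolding eq using B fin by auto
  have "disjoint_family_on B S"
    using bits_unique[of _ l] unfolding disjoint_family_on_def S_def by (fastforce simp: in_B)
  then have "\<mu> (\<Union>s\<in>S. B s) = (\<Sum>s\<in>S. \<mu> (B s))"
    using B fin by (intro cantor.finite_measure_finite_Union) auto
  also have "\<dots> = card S * (1/2) ^ (l + card J)" by (simp add: B)
  also have "real (card S) = (\<Sum>s<(2::nat) ^ l. of_bool (bit s \<in> C))"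
    unfolding S_def by (simp add: Int_def)
  finally show "\<mu> (C \<inter> {X. \<forall>i\<in>J. X i}) = (\<Sum>s<(2::nat) ^ l. of_bool (bit s \<in> C)) / 2 ^ l * (1/2) ^ card J"
    unfolding eq by (simp add: power_add power_divide)
qed

lemma depends_below_measurable: "depends_below l C \<Longrightarrow> C \<in> sets cantor_measure"
  using measure_depends_below_Int(1)[of l C "{}"] by simp

lemma measure_depends_below:
  "depends_below l C \<Longrightarrow> \<mu> C = (\<Sum>s<(2::nat) ^ l. of_bool (bit s \<in> C)) / 2 ^ l"
  using measure_depends_below_Int(2)[of l C "{}"] by simp

lemma independence:
  assumes "depends_below l C" "finite J" "\<And>i. i \<in> J \<Longrightarrow> l \<le> i"
  shows "\<mu> (C \<inter> {X. \<forall>i\<in>J. X i}) = \<mu> C * (1/2) ^ card J"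
  using measure_depends_below[OF assms(1)] measure_depends_below_Int(2)[OF assms] by simp

lemma depends_below_cylinder: "depends_below (len u) (cylinder (bin_string u))"
  unfolding depends_below_def cylinder_bin_string by auto

lemma cylinder_measurable [measurable, simp]: "cylinder (bin_string u) \<in> sets cantor_measure"
  by (rule depends_below_measurable[OF depends_below_cylinder])

lemma measure_cylinder: "\<mu> (cylinder (bin_string u)) = (1/2) ^ len u"
proof -
  have "cylinder (bin_string u) = {X. \<forall>i\<in>{..<len u}. X i = bit (Suc u) i}"
    unfolding cylinder_bin_string by auto
  then show ?thesis using box_measure(2)[of "{..<len u}"] by simp
qed

text \<open>The open sets of the product topology, in terms of basic neighbourhoods.\<close>

definition cantor_open :: "(nat \<Rightarrow> bool) set \<Rightarrow> bool" where
  "cantor_open V \<longleftrightarrow> (\<forall>X\<in>V. \<exists>l. \<forall>Y. (\<forall>i<l. X i = Y i) \<longrightarrow> Y \<in> V)"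

lemma depends_below_cantor_open: "depends_below l C \<Longrightarrow> cantor_open C"
  unfolding cantor_open_def depends_below_def by blast

lemma cantor_open_Union: "(\<And>V. V \<in> \<V> \<Longrightarrow> cantor_open V) \<Longrightarrow> cantor_open (\<Union>\<V>)"
  unfolding cantor_open_def by (intro ballI) (metis Union_iff)

lemma cantor_open_eq_cylinders:
  assumes "cantor_open V"
  shows "V = (\<Union>u\<in>{u. cylinder (bin_string u) \<subseteq> V}. cylinder (bin_string u))"
proof (intro set_eqI iffI)
  fix X assume "X \<in> V"
  then obtain l where l: "\<And>Y. (\<forall>i<l. X i = Y i) \<Longrightarrow> Y \<in> V"
    using assms unfolding cantor_open_def by blast
  obtain u where u: "len u = l" "X \<in> cylinder (bin_string u)" using ex_bin_string_cylinder by blast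
  then have "cylinder (bin_string u) \<subseteq> V"
    using l unfolding cylinder_bin_string by auto
  with u show "X \<in> (\<Union>u\<in>{u. cylinder (bin_string u) \<subseteq> V}. cylinder (bin_string u))" by blast
qed auto

lemma cantor_open_measurable:
  assumes "cantor_open V"
  shows "V \<in> sets cantor_measure"
  by (subst cantor_open_eq_cylinders[OF assms]) auto

section \<open>Computable sequences of clopen sets\<close>

text \<open>A number \<open>s\<close> stands for the sequence of its binary digits, so \<open>bit s \<in> C e\<close> is membership of a
  point with finite support. For a set that depends on finitely many bits this information is
  complete. Compared with coding a clopen set by a list of strings, it makes Boolean combinations
  trivial, because membership may be decided on more bits than necessary.\<close>

definition clopen_in :: "(nat \<Rightarrow> bool) \<Rightarrow> (nat \<Rightarrow> (nat \<Rightarrow> bool) set) \<Rightarrow> bool" where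
  "clopen_in A C \<longleftrightarrow> (\<exists>l. computable_in A l \<and> (\<forall>e. depends_below (l e) (C e)))
     \<and> decidable_in A (\<lambda>z. bit (psnd z) \<in> C (pfst z))"

lemma clopenI:
  assumes "computable_in A l" "\<And>e. depends_below (l e) (C e)"
    "decidable_in A (\<lambda>z. bit (psnd z) \<in> C (pfst z))"
  shows "clopen_in A C"
  using assms unfolding clopen_in_def by blast

lemma clopen_cantor_open: "clopen_in A C \<Longrightarrow> cantor_open (C e)"
  unfolding clopen_in_def using depends_below_cantor_open by blast

lemma clopen_measurable: "clopen_in A C \<Longrightarrow> C e \<in> sets cantor_measure"
  using clopen_cantor_open cantor_open_measurable by blast

lemma decidable_bit_in_clopen:
  assumes "clopen_in A C" "computable_in A f" "computable_in A g"
  shows "decidable_in A (\<lambda>x. bit (f x) \<in> C (g x))"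
proof -
  have "decidable_in A (\<lambda>z. bit (psnd z) \<in> C (pfst z))" using assms(1) unfolding clopen_in_def by blast
  from decidable_compose[OF this computable_pair[OF assms(3,2)]] show ?thesis by simp
qed

lemma clopen_compose:
  assumes "clopen_in A C" "computable_in A h"
  shows "clopen_in A (\<lambda>e. C (h e))"
proof -
  obtain l where l: "computable_in A l" "\<And>e. depends_below (l e) (C e)"
    using assms(1) unfolding clopen_in_def by blast
  show ?thesis
  proof (rule clopenI)
    show "computable_in A (\<lambda>e. l (h e))" by (rule computable_compose[OF l(1) assms(2)])
    show "decidable_in A (\<lambda>z. bit (psnd z) \<in> C (h (pfst z)))"
      by (intro decidable_bit_in_clopen[OF assms(1)] comp_intros computable_compose[OF assms(2)])
  qed (rule l(2))
qed

lemma clopen_Compl [comp_intros]: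
  assumes "clopen_in A C"
  shows "clopen_in A (\<lambda>e. - C e)"
proof -
  obtain l where l: "computable_in A l" "\<And>e. depends_below (l e) (C e)"
    "decidable_in A (\<lambda>z. bit (psnd z) \<in> C (pfst z))"
    using assms unfolding clopen_in_def by blast
  show ?thesis
  proof (rule clopenI[OF l(1)])
    show "depends_below (l e) (- C e)" for e
      using l(2) unfolding depends_below_def by (metis ComplD ComplI)
    show "decidable_in A (\<lambda>z. bit (psnd z) \<in> - C (pfst z))"
      using l(3) unfolding Compl_iff by (intro comp_intros)
  qed
qed

lemma clopen_UN [comp_intros]:
  assumes C: "clopen_in A (\<lambda>z. C (pfst z) (psnd z))" and b: "computable_in A b"
  shows "clopen_in A (\<lambda>e. \<Union>i<b e. C i e)"
proof -
  obtain l where l: "computable_in A l" "\<And>z. depends_below (l z) (C (pfst z) (psnd z))"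
    using C unfolding clopen_in_def by blast
  have l': "depends_below (l (pair i e)) (C i e)" for i e using l(2)[of "pair i e"] by simp
  show ?thesis
  proof (rule clopenI)
    show "computable_in A (\<lambda>e. \<Sum>i<b e. l (pair i e))"
      by (intro comp_intros b computable_compose[OF l(1)])
    show "depends_below (\<Sum>i<b e. l (pair i e)) (\<Union>i<b e. C i e)" for e
    proof -
      have "depends_below (\<Sum>i<b e. l (pair i e)) (C i e)" if "i < b e" for i
        using l' by (rule depends_below_mono) (use that in \<open>auto intro!: member_le_sum\<close>)
      then show ?thesis unfolding depends_below_def by blast
    qed
    have "decidable_in A (\<lambda>z. bit (psnd (psnd z)) \<in> C (pfst (pair (pfst z) (pfst (psnd z)))) (psnd (pair (pfst z) (pfst (psnd z)))))"
      by (rule decidable_bit_in_clopen[OF C]) (intro comp_intros)+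
    then have "decidable_in A (\<lambda>z. \<exists>i<b (pfst z). bit (psnd z) \<in> C i (pfst z))"
      by (intro comp_intros computable_compose[OF b]) simp
    moreover have "(\<exists>i<b (pfst z). bit (psnd z) \<in> C i (pfst z)) \<longleftrightarrow> bit (psnd z) \<in> (\<Union>i<b (pfst z). C i (pfst z))" for z
      by auto
    ultimately show "decidable_in A (\<lambda>z. bit (psnd z) \<in> (\<Union>i<b (pfst z). C i (pfst z)))" by simp
  qed
qed

lemma clopen_Un [comp_intros]:
  assumes C: "clopen_in A C" and D: "clopen_in A D"
  shows "clopen_in A (\<lambda>e. C e \<union> D e)"
proof -
  obtain l where l: "computable_in A l" "\<And>e. depends_below (l e) (C e)"
    using C unfolding clopen_in_def by blast
  obtain m where m: "computable_in A m" "\<And>e. depends_below (m e) (D e)"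
    using D unfolding clopen_in_def by blast
  show ?thesis
  proof (rule clopenI)
    show "computable_in A (\<lambda>e. l e + m e)" using l m by (intro comp_intros)
    show "depends_below (l e + m e) (C e \<union> D e)" for e
      using depends_below_mono[OF l(2), of e "l e + m e"] depends_below_mono[OF m(2), of e "l e + m e"]
      unfolding depends_below_def by auto
    show "decidable_in A (\<lambda>z. bit (psnd z) \<in> C (pfst z) \<union> D (pfst z))"
      unfolding Un_iff by (intro comp_intros decidable_bit_in_clopen[OF C] decidable_bit_in_clopen[OF D])
  qed
qed

lemma clopen_Int [comp_intros]:
  assumes "clopen_in A C" "clopen_in A D"
  shows "clopen_in A (\<lambda>e. C e \<inter> D e)"
proof -
  have "clopen_in A (\<lambda>e. - (- C e \<union> - D e))" using assms by (intro comp_intros)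
  then show ?thesis by simp
qed

lemma clopen_Diff [comp_intros]:
  assumes "clopen_in A C" "clopen_in A D"
  shows "clopen_in A (\<lambda>e. C e - D e)"
  unfolding Diff_eq using assms by (intro comp_intros)

lemma clopen_decidable [comp_intros]:
  assumes "decidable_in A P"
  shows "clopen_in A (\<lambda>e. {X. P e})"
proof (rule clopenI)
  show "computable_in A (\<lambda>_. 0)" by (intro comp_intros)
  show "decidable_in A (\<lambda>z. bit (psnd z) \<in> {X. P (pfst z)})"
    unfolding mem_Collect_eq by (intro decidable_compose[OF assms] comp_intros)
qed (simp add: depends_below_def)

lemma clopen_restrict:
  assumes "decidable_in A P" "clopen_in A C"
  shows "clopen_in A (\<lambda>e. if P e then C e else {})"
proof -
  have "clopen_in A (\<lambda>e. {X. P e} \<inter> C e)" using assms by (intro comp_intros)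
  moreover have "{X. P e} \<inter> C e = (if P e then C e else {})" for e by auto
  ultimately show ?thesis by simp
qed

lemma clopen_point [comp_intros]:
  assumes "computable_in A h"
  shows "clopen_in A (\<lambda>e. {X. X (h e)})"
proof (rule clopenI)
  show "computable_in A (\<lambda>e. Suc (h e))" using assms by (intro comp_intros)
  show "decidable_in A (\<lambda>z. bit (psnd z) \<in> {X. X (h (pfst z))})"
    unfolding mem_Collect_eq by (intro comp_intros computable_compose[OF assms])
qed (auto simp: depends_below_def)

lemma clopen_cylinder [comp_intros]:
  assumes h: "computable_in A h"
  shows "clopen_in A (\<lambda>e. cylinder (bin_string (h e)))"
proof (rule clopenI)
  show "computable_in A (\<lambda>e. len (h e))" using h by (intro comp_intros)
  show "decidable_in A (\<lambda>z. bit (psnd z) \<in> cylinder (bin_string (h (pfst z))))"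
    unfolding cylinder_bin_string mem_Collect_eq by (intro comp_intros computable_compose[OF h])
qed (rule depends_below_cylinder)

lemma dyadic_measure_clopen:
  assumes C: "clopen_in A C"
  shows "dyadic_in A (\<lambda>e. \<mu> (C e))"
proof -
  obtain l where l: "computable_in A l" "\<And>e. depends_below (l e) (C e)"
    using C unfolding clopen_in_def by blast
  show ?thesis
  proof (rule dyadicI[OF _ l(1)])
    show "computable_in A (\<lambda>e. \<Sum>s<(2::nat) ^ l e. of_bool (bit s \<in> C e))"
      by (intro comp_intros l(1) decidable_bit_in_clopen[OF C])
    show "\<mu> (C e) = real (\<Sum>s<(2::nat) ^ l e. of_bool (bit s \<in> C e)) / 2 ^ l e" for e
      using measure_depends_below[OF l(2)] by simp
  qed
qed

text \<open>The enumeration lists all strings that are long enough for their cylinder to be contained in or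
  disjoint from the clopen set, and that belong to it.\<close>

lemma clopen_uniformly_ce:
  assumes C: "clopen_in A C"
  shows "uniformly_ce_open_in A (\<lambda>n. \<Union>t. C (pair n t))"
proof -
  obtain l where l: "computable_in A l" "\<And>e. depends_below (l e) (C e)"
    using C unfolding clopen_in_def by blast
  define e where "e = (\<lambda>n z. let t = pfst z; u = psnd z in
     if l (pair n t) \<le> len u \<and> bit (Suc u) \<in> C (pair n t) then Suc u else 0)"
  have "computable2_in A e"
    unfolding computable2_iff e_def Let_def
    by (intro comp_intros computable_compose[OF l(1)] decidable_bit_in_clopen[OF C])
  moreover have "(\<Union>t. C (pair n t)) = (\<Union>u\<in>{u. \<exists>z. e n z = Suc u}. cylinder (bin_string u))" for n
  proof (intro set_eqI iffI)
    fix X assume "X \<in> (\<Union>t. C (pair n t))"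
    then obtain t where t: "X \<in> C (pair n t)" by blast
    obtain u where u: "len u = l (pair n t)" "X \<in> cylinder (bin_string u)"
      using ex_bin_string_cylinder by blast
    have "bit (Suc u) \<in> C (pair n t)"
      using depends_belowD[OF l(2), of "pair n t" "bit (Suc u)" X] u t by (auto simp: cylinder_bin_string)
    then have "e n (pair t u) = Suc u" using u by (simp add: e_def Let_def)
    with u show "X \<in> (\<Union>u\<in>{u. \<exists>z. e n z = Suc u}. cylinder (bin_string u))" by blast
  next
    fix X assume "X \<in> (\<Union>u\<in>{u. \<exists>z. e n z = Suc u}. cylinder (bin_string u))"
    then obtain u z where u: "X \<in> cylinder (bin_string u)" "e n z = Suc u" by blast
    then have "l (pair n (pfst z)) \<le> len u" "bit (Suc u) \<in> C (pair n (pfst z))"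
      by (auto simp: e_def Let_def split: if_splits)
    then have "X \<in> C (pair n (pfst z))"
      using depends_belowD[OF l(2), of "pair n (pfst z)" "bit (Suc u)" X] u
      by (auto simp: cylinder_bin_string)
    then show "X \<in> (\<Union>t. C (pair n t))" by blast
  qed
  ultimately show ?thesis unfolding uniformly_ce_open_in_def by blast
qed

section \<open>Computable real functions with computable sum\<close>

text \<open>Round an approximation with error \<open>2\<close> to the power \<open>-(k + 2)\<close> to the nearest multiple of \<open>2\<close>
  to the power \<open>-k\<close>: in units of the latter, the two errors are at most \<open>1/4\<close> and \<open>1/2\<close>. A
  negative approximation is truncated to \<open>0\<close>, which brings it closer to the nonnegative value.\<close>

lemma dyadic_approximation:
  assumes "computable_realfun_in A f" and nonneg: "\<And>n. 0 \<le> f n"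
  obtains q where "dyadic_in A (\<lambda>z. q (pfst z) (psnd z))" "\<And>n k. \<bar>f n - q n k\<bar> \<le> (1/2) ^ k"
proof -
  obtain a b c where abc: "computable2_in A a" "computable2_in A b" "computable2_in A c"
    and approx: "\<And>n k. \<bar>f n - (real (a n k) - real (b n k)) / (real (c n k) + 1)\<bar> \<le> (1/2) ^ k"
    using assms(1) unfolding computable_realfun_in_def by metis
  define r where "r = (\<lambda>n k. let m = k + 2 in
    (2 * 2 ^ k * (a n m - b n m) + Suc (c n m)) div (2 * Suc (c n m)))"
  show ?thesis
  proof
    have *: "computable_in A (\<lambda>z. h (pfst z) (psnd z + 2))" if "computable2_in A h" for h
    proof -
      have "computable_in A (\<lambda>z. pair (pfst z) (psnd z + 2))" by (intro comp_intros)
      from computable_compose[OF that[unfolded computable2_iff] this] show ?thesis by simp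
    qed
    have "computable_in A (\<lambda>z. r (pfst z) (psnd z))"
      unfolding r_def Let_def by (intro comp_intros * abc)
    then show "dyadic_in A (\<lambda>z. real (r (pfst z) (psnd z)) * (1/2) ^ psnd z)"
      by (intro comp_intros)
    fix n k
    define d where "d = Suc (c n (k + 2))"
    define m where "m = a n (k + 2) - b n (k + 2)"
    have d: "0 < d" by (simp add: d_def)
    have app: "\<bar>f n - real m / real d\<bar> \<le> (1/2) ^ (k + 2)"
    proof (cases "b n (k + 2) \<le> a n (k + 2)")
      case True
      then show ?thesis using approx[of n "k + 2"] by (simp add: m_def d_def of_nat_diff add.commute)
    next
      case False
      then have "(real (a n (k + 2)) - real (b n (k + 2))) / (real (c n (k + 2)) + 1) \<le> 0"
        by (intro divide_nonpos_pos) auto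
      then have "f n \<le> (1/2) ^ (k + 2)" using approx[of n "k + 2"] by linarith
      moreover have "m = 0" using False by (simp add: m_def)
      ultimately show ?thesis using nonneg[of n] by simp
    qed
    define x where "x = 2 * 2 ^ k * m + d"
    have r: "r n k = x div (2 * d)" by (simp add: r_def Let_def d_def m_def x_def)
    have "r n k * (2 * d) \<le> x" "x < (r n k + 1) * (2 * d)"
      unfolding r using d dividend_less_div_times[of "2 * d" x] by simp_all
    then have "real (r n k * (2 * d)) \<le> real x" "real x < real ((r n k + 1) * (2 * d))"
      by (simp_all only: of_nat_le_iff of_nat_less_iff)
    then have "real (r n k) * (2 * d) \<le> x" "x < (real (r n k) + 1) * (2 * d)"
      by (simp_all add: algebra_simps)
    moreover have "real x = 2 * 2 ^ k * m + d" by (simp add: x_def)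
    ultimately have "real (r n k) \<le> 2 ^ k * (real m / d) + 1/2" "2 ^ k * (real m / d) - 1/2 \<le> real (r n k)"
      using d by (simp_all add: field_simps)
    then have "\<bar>2 ^ k * (real m / d) - real (r n k)\<bar> \<le> 1/2" by (simp only: abs_le_iff) linarith
    moreover have "\<bar>2 ^ k * f n - 2 ^ k * (real m / d)\<bar> \<le> 1/4"
    proof -
      have "\<bar>2 ^ k * f n - 2 ^ k * (real m / d)\<bar> = 2 ^ k * \<bar>f n - real m / d\<bar>"
        by (simp only: right_diff_distrib[symmetric] abs_mult) simp
      also have "\<dots> \<le> 2 ^ k * (1/2) ^ (k + 2)" using app by (intro mult_left_mono) auto
      finally show ?thesis by (simp add: power_add power_divide)
    qed
    ultimately have "\<bar>2 ^ k * f n - real (r n k)\<bar> \<le> 1" by linarith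
    then have "\<bar>2 ^ k * f n - real (r n k)\<bar> * (1/2) ^ k \<le> 1 * (1/2) ^ k"
      by (rule mult_right_mono) simp
    moreover have "\<bar>2 ^ k * f n - real (r n k)\<bar> * (1/2) ^ k = \<bar>(2 ^ k * f n - real (r n k)) * (1/2) ^ k\<bar>"
      by (simp add: abs_mult)
    moreover have "(2 ^ k * f n - real (r n k)) * (1/2) ^ k = f n - real (r n k) * (1/2) ^ k"
      by (simp add: field_simps power_divide)
    ultimately show "\<bar>f n - real (r n k) * (1/2) ^ k\<bar> \<le> (1/2) ^ k" by simp
  qed
qed

lemma computable_realfunI:
  assumes q: "dyadic_in A (\<lambda>z. q (pfst z) (psnd z))" and app: "\<And>n k. \<bar>f n - q n k\<bar> \<le> (1/2) ^ k"
  shows "computable_realfun_in A f"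
proof -
  obtain a l where al: "computable_in A a" "computable_in A l"
    "\<And>z. q (pfst z) (psnd z) = real (a z) / 2 ^ l z"
    using q unfolding dyadic_in_def by blast
  have q_eq: "q n k = (real (a (pair n k)) - real 0) / (real (2 ^ l (pair n k) - 1) + 1)" for n k
    using al(3)[of "pair n k"] by (simp add: of_nat_diff)
  have *: "computable2_in A (\<lambda>n k. a (pair n k))" "computable2_in A (\<lambda>n k. 0)"
    "computable2_in A (\<lambda>n k. 2 ^ l (pair n k) - 1)"
    unfolding computable2_iff using al(1,2) by (simp_all) (intro comp_intros)+
  show ?thesis
    unfolding computable_realfun_in_def
    by (intro exI[of _ "\<lambda>n k. a (pair n k)"] exI[of _ "\<lambda>n k. 0"] exI[of _ "\<lambda>n k. 2 ^ l (pair n k) - 1"]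
        conjI * allI) (use app in \<open>simp only: q_eq\<close>)
qed

lemma dyadic_computable_realfun: "dyadic_in A f \<Longrightarrow> computable_realfun_in A f"
  by (rule computable_realfunI[where q = "\<lambda>n k. f n"]) (auto intro: dyadic_compose[OF _ computable_pfst[OF computable_id]])

text \<open>If the terms and the sum are computable, one can search for a partial sum that is provably
  close to the total.\<close>

lemma computable_tail_modulus:
  assumes f: "computable_realfun_in A f" and nonneg: "\<And>n. 0 \<le> f n"
    and "summable f" and sum: "computable_real_in A (\<Sum>n. f n)"
  obtains N where "computable_in A N" "\<And>j. (\<Sum>n. f (n + N j)) \<le> (1/2) ^ j"
proof -
  obtain q where q: "dyadic_in A (\<lambda>z. q (pfst z) (psnd z))" "\<And>n k. \<bar>f n - q n k\<bar> \<le> (1/2) ^ k"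
    using dyadic_approximation[OF f nonneg] by metis
  obtain s where s: "dyadic_in A (\<lambda>z. s (pfst z) (psnd z))" "\<And>n k. \<bar>(\<Sum>n. f n) - s n k\<bar> \<le> (1/2) ^ k"
    using dyadic_approximation[OF sum[unfolded computable_real_in_def]] suminf_nonneg[OF assms(3) nonneg]
    by metis
  (* With precision k the partial sum of M terms has error at most M / 2 ^ k <= 2 ^ (-j-3), so the
     test succeeds as soon as the tail is below 2 ^ (-j-1). *)
  define test where "test = (\<lambda>M j. let k = j + M + 3 in
    s 0 k + (1/2) ^ k + real M * (1/2) ^ k \<le> (\<Sum>n<M. q n k) + (1/2) ^ j)"
  have tail: "(\<Sum>n. f (n + M)) = (\<Sum>n. f n) - (\<Sum>n<M. f n)" for M
    using suminf_minus_initial_segment[OF assms(3)] by simp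
  have q': "\<bar>(\<Sum>n<M. f n) - (\<Sum>n<M. q n k)\<bar> \<le> real M * (1/2) ^ k" for M k
  proof -
    have "\<bar>(\<Sum>n<M. f n) - (\<Sum>n<M. q n k)\<bar> \<le> (\<Sum>n<M. \<bar>f n - q n k\<bar>)"
      by (simp add: sum_abs flip: sum_subtractf)
    also have "\<dots> \<le> (\<Sum>n<M. (1/2) ^ k)" by (intro sum_mono q)
    finally show ?thesis by simp
  qed
  have ex: "\<exists>M. test M j" for j
  proof -
    have "(\<lambda>M. \<Sum>n. f (n + M)) \<longlonglongrightarrow> 0" by (rule suminf_exist_split2[OF assms(3)])
    then have "\<forall>\<^sub>F M in sequentially. (\<Sum>n. f (n + M)) < (1/2) ^ (j + 1)"
      by (rule order_tendstoD) simp
    then obtain M where M: "(\<Sum>n. f (n + M)) < (1/2) ^ (j + 1)"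
      unfolding eventually_sequentially by blast
    define k where "k = j + M + 3"
    have "real (M + 1) \<le> 2 ^ (M + 1)" by (metis less_imp_le of_nat_less_two_power)
    then have "real (M + 1) * (1/2) ^ (M + 1) \<le> 1" by (simp add: field_simps power_divide)
    then have "real (M + 1) * (1/2) ^ (M + 1) * (1/2) ^ (j + 1) \<le> 1 * (1/2) ^ (j + 1)"
      by (intro mult_right_mono) auto
    then have "2 * (real (M + 1) * (1/2) ^ k) \<le> (1/2) ^ (j + 1)"
      unfolding k_def by (simp add: power_add field_simps)
    then have "2 * (1/2) ^ k + 2 * (real M * (1/2) ^ k) \<le> (1/2) ^ (j + 1)"
      by (simp add: algebra_simps)
    moreover have "(1/2) ^ j = (1/2) ^ (j + 1) + (1/2 :: real) ^ (j + 1)" by simp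
    ultimately have "test M j"
      using M q'[of M k] s(2)[of 0 k] unfolding test_def Let_def k_def[symmetric] tail
      by linarith
    then show "\<exists>M. test M j" by blast
  qed
  have "computable_in A (\<lambda>j. LEAST M. test M j)"
  proof (rule computable_Least)
    have *: "dyadic_in A (\<lambda>z. q (g z) (h z))" if "computable_in A g" "computable_in A h" for g h
      using dyadic_compose[OF q(1) computable_pair[OF that]] by simp
    have **: "dyadic_in A (\<lambda>z. s (g z) (h z))" if "computable_in A g" "computable_in A h" for g h
      using dyadic_compose[OF s(1) computable_pair[OF that]] by simp
    show "decidable_in A (\<lambda>z. test (pfst z) (psnd z))"
      unfolding test_def Let_def by (intro comp_intros * **)
  qed (rule ex)
  moreover have "(\<Sum>n. f (n + (LEAST M. test M j))) \<le> (1/2) ^ j" for j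
  proof -
    define M where "M = (LEAST M. test M j)"
    have "test M j" unfolding M_def using ex by (rule LeastI_ex)
    then show ?thesis
      unfolding M_def[symmetric]
      using q'[of M "j + M + 3"] s(2)[of 0 "j + M + 3"]
      unfolding test_def Let_def tail by linarith
  qed
  ultimately show ?thesis using that by blast
qed

text \<open>The converse: the partial sums up to the modulus are exact dyadic approximations of the total.\<close>

lemma computable_sum_of_modulus:
  assumes g: "dyadic_in A g" and N: "computable_in A N"
    and tail: "\<And>j R. (\<Sum>n=N j..<R. g n) \<le> (1/2) ^ j"
  shows "summable g" "computable_real_in A (\<Sum>n. g n)"
proof -
  have nonneg: "0 \<le> g n" for n using g by (rule dyadic_nonneg)
  have "(\<Sum>n<R. g n) \<le> (\<Sum>n<N 0. g n) + 1" for R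
  proof -
    have "(\<Sum>n<R. g n) \<le> (\<Sum>n\<in>{..<N 0} \<union> {N 0..<R}. g n)"
      by (intro sum_mono2) (auto simp: nonneg)
    also have "\<dots> = (\<Sum>n<N 0. g n) + (\<Sum>n=N 0..<R. g n)"
      by (intro sum.union_disjoint) auto
    finally show ?thesis using tail[of 0 R] by simp
  qed
  then show summable: "summable g"
    by (rule summableI_nonneg_bounded[OF nonneg])
  have "\<bar>(\<Sum>n. g n) - (\<Sum>n<N k. g n)\<bar> \<le> (1/2) ^ k" for k
  proof -
    have "(\<Sum>n. g (n + N k)) \<le> (1/2) ^ k"
    proof (rule suminf_le_const)
      show "summable (\<lambda>n. g (n + N k))" using summable by (simp add: summable_iff_shift)
      show "(\<Sum>n<R. g (n + N k)) \<le> (1/2) ^ k" for R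
        using tail[of k "R + N k"] sum.shift_bounds_nat_ivl[of g 0 "N k" R] by (simp add: lessThan_atLeast0)
    qed
    moreover have "0 \<le> (\<Sum>n. g (n + N k))"
      using summable nonneg by (intro suminf_nonneg) (auto simp: summable_iff_shift)
    ultimately show ?thesis using suminf_minus_initial_segment[OF summable, of "N k"] by simp
  qed
  moreover have "dyadic_in A (\<lambda>z. \<Sum>n<N (psnd z). g n)"
    by (intro comp_intros dyadic_compose[OF g] computable_compose[OF N])
  ultimately show "computable_real_in A (\<Sum>n. g n)"
    unfolding computable_real_in_def by (intro computable_realfunI[where q = "\<lambda>n k. \<Sum>n<N k. g n"])
qed

section \<open>Schnorr tests from effectively small tails\<close>

text \<open>The first \<open>l\<close> bits as a number with the most significant bit first. This order makes sets of the
  form \<open>rev_val X l < i\<close> comparable for different \<open>l\<close>: they are initial segments of the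
  lexicographic order.\<close>

primrec rev_val :: "(nat \<Rightarrow> bool) \<Rightarrow> nat \<Rightarrow> nat" where
  "rev_val X 0 = 0"
| "rev_val X (Suc l) = 2 * rev_val X l + of_bool (X l)"

lemma rev_val_less: "rev_val X l < 2 ^ l"
  by (induction l) auto

lemma rev_val_cong: "(\<And>i. i < l \<Longrightarrow> X i = Y i) \<Longrightarrow> rev_val X l = rev_val Y l"
  by (induction l) auto

lemma rev_val_inj: "rev_val X l = rev_val Y l \<Longrightarrow> i < l \<Longrightarrow> X i = Y i"
proof (induction l)
  case (Suc l)
  have "rev_val X l = rev_val Y l \<and> X l = Y l"
    using Suc.prems(1) by (cases "X l"; cases "Y l") (simp_all, presburger+)
  then show ?case using Suc by (cases "i = l") auto
qed simp

lemma rev_val_div: "rev_val X (l + d) div 2 ^ d = rev_val X l"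
proof (induction d)
  case (Suc d)
  have "rev_val X (l + Suc d) div 2 ^ Suc d = rev_val X (Suc (l + d)) div 2 div 2 ^ d"
    by (simp add: div_mult2_eq)
  also have "rev_val X (Suc (l + d)) div 2 = rev_val X (l + d)" by simp
  finally show ?case using Suc by simp
qed simp

text \<open>The points below the dyadic rational \<open>i / 2 ^ l\<close> when a sequence is read as a binary
  expansion.\<close>

definition init_seg :: "nat \<Rightarrow> nat \<Rightarrow> (nat \<Rightarrow> bool) set" where
  "init_seg l i = {X. rev_val X l < i}"

lemma depends_below_init_seg: "depends_below l (init_seg l i)"
  unfolding depends_below_def init_seg_def using rev_val_cong by (metis mem_Collect_eq)

lemma init_seg_measurable [simp]: "init_seg l i \<in> sets cantor_measure"
  by (rule depends_below_measurable[OF depends_below_init_seg])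

lemma init_seg_mono: "i \<le> j \<Longrightarrow> init_seg l i \<subseteq> init_seg l j"
  unfolding init_seg_def by auto

lemma init_seg_refine: "init_seg l i = init_seg (l + d) (i * 2 ^ d)"
proof -
  have "rev_val X l < i \<longleftrightarrow> rev_val X (l + d) < i * 2 ^ d" for X
    using div_less_iff_less_mult[of "2 ^ d" "rev_val X (l + d)" i] by (simp add: rev_val_div)
  then show ?thesis by (simp add: init_seg_def)
qed

lemma init_seg_chain: "init_seg l i \<subseteq> init_seg m j \<or> init_seg m j \<subseteq> init_seg l i"
proof -
  have *: "init_seg l i \<subseteq> init_seg (l + d) j \<or> init_seg (l + d) j \<subseteq> init_seg l i" for l i d j
    unfolding init_seg_refine[of l i d] using init_seg_mono nat_le_linear by metis
  show ?thesis
    using *[of l i "m - l" j] *[of m j "l - m" i] by (cases "l \<le> m") auto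
qed

text \<open>The sequences whose first \<open>l\<close> bits have a given value lie in one cylinder, so moving
  the end point by one step adds at most its measure.\<close>

lemma measure_init_seg_step:
  assumes S: "S \<in> sets cantor_measure"
  shows "\<mu> (S \<union> init_seg l (Suc i)) \<le> \<mu> (S \<union> init_seg l i) + (1/2) ^ l"
proof -
  have "\<exists>u. len u = l \<and> {X. rev_val X l = i} \<subseteq> cylinder (bin_string u)"
  proof (cases "\<exists>Y. rev_val Y l = i")
    case True
    then obtain Y where Y: "rev_val Y l = i" by blast
    obtain u where u: "len u = l" "Y \<in> cylinder (bin_string u)" using ex_bin_string_cylinder by blast
    have "X \<in> cylinder (bin_string u)" if "rev_val X l = i" for X
      using u rev_val_inj[of X l Y] Y that by (auto simp: cylinder_def)
    with u show ?thesis by blast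
  next
    case False
    then show ?thesis using ex_bin_string_cylinder by blast
  qed
  then obtain u where u: "len u = l" "{X. rev_val X l = i} \<subseteq> cylinder (bin_string u)" by blast
  have "S \<union> init_seg l (Suc i) \<subseteq> (S \<union> init_seg l i) \<union> cylinder (bin_string u)"
    using u(2) by (auto simp: init_seg_def less_Suc_eq)
  then have "\<mu> (S \<union> init_seg l (Suc i)) \<le> \<mu> ((S \<union> init_seg l i) \<union> cylinder (bin_string u))"
    by (rule cantor.finite_measure_mono)
      (intro sets.Un S init_seg_measurable cylinder_measurable)
  also have "\<dots> \<le> \<mu> (S \<union> init_seg l i) + \<mu> (cylinder (bin_string u))"
    using S by (intro measure_Un_le) auto
  finally show ?thesis by (simp add: measure_cylinder u(1))
qed

lemma clopen_rev_val:
  assumes P: "decidable_in A (\<lambda>z. P (pfst z) (psnd z))" and h: "computable_in A h"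
  shows "clopen_in A (\<lambda>e. {X. P e (rev_val X (h e))})"
proof (rule clopenI[OF h])
  show "depends_below (h e) {X. P e (rev_val X (h e))}" for e
    unfolding depends_below_def using rev_val_cong by (metis mem_Collect_eq)
  have "computable_in A (\<lambda>z. rec_nat 0 (\<lambda>i r. 2 * r + of_bool (bit (psnd z) i)) (h (pfst z)))"
    by (rule computable_rec_nat) (intro comp_intros computable_compose[OF h])+
  moreover have "rec_nat 0 (\<lambda>i r. 2 * r + of_bool (X i)) l = rev_val X l" for X l
    by (induction l) auto
  ultimately have "computable_in A (\<lambda>z. rev_val (bit (psnd z)) (h (pfst z)))" by simp
  then have "computable_in A (\<lambda>z. pair (pfst z) (rev_val (bit (psnd z)) (h (pfst z))))"
    by (intro comp_intros)
  from decidable_compose[OF P this]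
  show "decidable_in A (\<lambda>z. bit (psnd z) \<in> {X. P (pfst z) (rev_val X (h (pfst z)))})" by simp
qed

lemma UN_shift: "(\<Union>t. C (t + N)) = (\<Union>m\<in>{N..}. C m)" for N :: nat
proof -
  have "m \<in> range (\<lambda>t. t + N)" if "N \<le> m" for m
    using that by (intro image_eqI[of _ _ "m - N"]) auto
  then have "{N..} = range (\<lambda>t. t + N)" by auto
  then show ?thesis by simp
qed

text \<open>Packing clopen sets with effectively small tails into a Schnorr test. The tails \<open>V (Suc n)\<close> are a
  decreasing sequence of c.e. open sets of measure at most half of what is required; only the exact
  measure \<open>2\<close> to the power \<open>-n\<close> has to be achieved. So \<open>V (Suc n)\<close> is padded with an initial segment
  of Cantor space. Its exact end point need not be computable, but it is approximated from below:
  at level \<open>l\<close> take the longest segment with end point a multiple of \<open>2\<close> to the power \<open>-l\<close> for which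
  an approximation of the measure, based on the sets before \<open>N l\<close>, leaves room for the
  unseen remainder of measure at most \<open>2\<close> to the power \<open>-l\<close>. The pads at one level decrease with
  \<open>n\<close>, because \<open>V (Suc n)\<close> occupies at most the measure that is gained in passing from \<open>Suc n\<close> to
  \<open>n\<close>.\<close>

lemma ex_schnorr_test_aux:
  assumes C: "clopen_in A C" and N: "computable_in A N" and mono: "mono N"
    and tail: "\<And>j. \<mu> (\<Union>t. C (t + N j)) \<le> (1/2) ^ j"
  shows "\<exists>W. schnorr_test_in A W \<and> (\<forall>n. \<forall>m\<ge>N (Suc n). C m \<subseteq> W n)"
proof -
  define V where "V = (\<lambda>j. \<Union>t. C (t + N j))"
  define B where "B = (\<lambda>n l. \<Union>m<N l. {X. N (Suc n) \<le> m} \<inter> C m)"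
  define room where "room = (\<lambda>n l i. \<mu> (B n l \<union> init_seg l i) + (1/2) ^ l \<le> (1/2) ^ n)"
  define E where "E = (\<lambda>n l. {X. room n l (Suc (rev_val X l))})"
  define D where "D = (\<lambda>e. ({X. N (Suc (pfst e)) \<le> psnd e} \<inter> C (psnd e)) \<union> E (pfst e) (psnd e))"
  define W where "W = (\<lambda>n. \<Union>t. D (pair n t))"

  have "clopen_in A (\<lambda>w. B (pfst w) (pfst (psnd w)) \<union> {X. rev_val X (pfst (psnd w)) < psnd (psnd w)})"
    unfolding B_def
    by (intro comp_intros computable_compose[OF N] clopen_compose[OF C] clopen_rev_val)
  from dyadic_measure_clopen[OF this]
  have "decidable_in A (\<lambda>w. room (pfst w) (pfst (psnd w)) (psnd (psnd w)))"
    unfolding room_def init_seg_def by (intro comp_intros)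
  from decidable_compose[OF this, of "\<lambda>z. pair (pfst (pfst z)) (pair (psnd (pfst z)) (Suc (psnd z)))"]
  have "decidable_in A (\<lambda>z. room (pfst (pfst z)) (psnd (pfst z)) (Suc (psnd z)))"
    by (simp add: comp_intros)
  then have "clopen_in A (\<lambda>e. E (pfst e) (psnd e))"
    unfolding E_def by (rule clopen_rev_val) (intro comp_intros)
  then have D: "clopen_in A D"
    unfolding D_def by (intro comp_intros computable_compose[OF N] clopen_compose[OF C])
  have ce: "uniformly_ce_open_in A W"
    unfolding W_def by (rule clopen_uniformly_ce[OF D])

  have C_meas [measurable]: "C m \<in> sets cantor_measure" for m using C by (rule clopen_measurable)
  have V_eq: "V j = (\<Union>m\<in>{N j..}. C m)" for j
    unfolding V_def by (rule UN_shift)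
  have V_meas [measurable, simp]: "V j \<in> sets cantor_measure" for j
    unfolding V_def by measurable
  have B_eq: "B n l = (\<Union>m\<in>{N (Suc n)..<N l}. C m)" for n l
    unfolding B_def by (auto split: if_splits)
  have B_meas [measurable, simp]: "B n l \<in> sets cantor_measure" for n l
    unfolding B_eq by measurable
  have V_B: "V (Suc n) \<subseteq> B n l \<union> V l" "B n l \<subseteq> V (Suc n)" for n l
  proof -
    have "{N (Suc n)..} \<subseteq> {N (Suc n)..<N l} \<union> {N l..}" by auto
    then show "V (Suc n) \<subseteq> B n l \<union> V l" unfolding V_eq B_eq by blast
    show "B n l \<subseteq> V (Suc n)" unfolding V_eq B_eq by (rule UN_mono) auto
  qed
  have mV: "\<mu> (V j) \<le> (1/2) ^ j" for j using tail unfolding V_def .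

  have room_antimono: "room n l i" if "room n l j" "i \<le> j" for n l i j
  proof -
    have "\<mu> (B n l \<union> init_seg l i) \<le> \<mu> (B n l \<union> init_seg l j)"
      using init_seg_mono[OF that(2), of l] by (intro cantor.finite_measure_mono) auto
    then show ?thesis using that(1) unfolding room_def by linarith
  qed
  have room_full: "\<not> room n l (2 ^ l)" for n l
  proof -
    have "init_seg l (2 ^ l) = UNIV" by (simp add: init_seg_def rev_val_less)
    then have "\<mu> (B n l \<union> init_seg l (2 ^ l)) = 1" using cantor.prob_space by simp
    moreover have "(1/2 :: real) ^ n \<le> 1" by (rule power_le_one) auto
    moreover have "(0::real) < (1/2) ^ l" by simp
    ultimately show ?thesis unfolding room_def by linarith
  qed
  (* room is closed downwards in i, so E n l is a single initial segment, maximal with room. *)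
  have pad: "\<exists>k. E n l = init_seg l k \<and> (k = 0 \<or> room n l k) \<and> \<not> room n l (Suc k)" for n l
  proof -
    have ex: "\<exists>k. \<not> room n l (Suc k)" using room_full[of n l] by (intro exI[of _ "2 ^ l - 1"]) simp
    define k where "k = (LEAST k. \<not> room n l (Suc k))"
    have k: "\<not> room n l (Suc k)" unfolding k_def using ex by (rule LeastI_ex)
    have less: "room n l (Suc j)" if "j < k" for j
      using not_less_Least[of j "\<lambda>k. \<not> room n l (Suc k)"] that unfolding k_def by blast
    have "room n l (Suc j) \<longleftrightarrow> j < k" for j
      using less k room_antimono[of n l "Suc j" "Suc k"] by (cases "j < k") auto
    then have "E n l = init_seg l k" unfolding E_def init_seg_def by simp
    moreover have "k = 0 \<or> room n l k" using less[of "k - 1"] by (cases k) auto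
    ultimately show ?thesis using k by blast
  qed
  have E_meas [measurable, simp]: "E n l \<in> sets cantor_measure" for n l
    using pad[of n l] init_seg_measurable by metis
  have E_upper: "\<mu> (V (Suc n) \<union> E n l) \<le> (1/2) ^ n" for n l
  proof -
    obtain k where k: "E n l = init_seg l k" "k = 0 \<or> room n l k" using pad by blast
    from k(2) show ?thesis
    proof
      assume "k = 0"
      then have "E n l = {}" using k(1) by (simp add: init_seg_def)
      (* Without a pad the bound comes from the index shift in V (Suc n). *)
      then have "\<mu> (V (Suc n) \<union> E n l) \<le> (1/2) ^ Suc n" using mV[of "Suc n"] by simp
      also have "\<dots> \<le> (1/2) ^ n" by simp
      finally show ?thesis .
    next
      assume room: "room n l k"
      have "\<mu> (V (Suc n) \<union> E n l) \<le> \<mu> ((B n l \<union> init_seg l k) \<union> V l)"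
        using V_B(1)[of n l] k(1)
        by (intro cantor.finite_measure_mono sets.Un B_meas init_seg_measurable V_meas) auto
      also have "\<dots> \<le> \<mu> (B n l \<union> init_seg l k) + \<mu> (V l)"
        by (intro measure_Un_le) auto
      finally show ?thesis using room mV[of l] unfolding room_def by linarith
    qed
  qed
  have E_lower: "(1/2) ^ n - 2 * (1/2) ^ l \<le> \<mu> (V (Suc n) \<union> E n l)" for n l
  proof -
    obtain k where k: "E n l = init_seg l k" "\<not> room n l (Suc k)" using pad by blast
    have "\<mu> (B n l \<union> init_seg l k) \<le> \<mu> (V (Suc n) \<union> E n l)"
      using V_B(2)[of n l] k(1) by (intro cantor.finite_measure_mono) auto
    then show ?thesis
      using k(2) measure_init_seg_step[of "B n l" l k] unfolding room_def by simp
  qed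

  have W_eq: "W n = (\<Union>L. V (Suc n) \<union> (\<Union>l\<le>L. E n l))" for n
  proof -
    have "W n = V (Suc n) \<union> (\<Union>l. E n l)"
      unfolding W_def D_def V_eq by (auto split: if_splits)
    then show ?thesis by auto
  qed
  have measure_W: "\<mu> (W n) = (1/2) ^ n" for n
  proof -
    define F where "F = (\<lambda>L. V (Suc n) \<union> (\<Union>l\<le>L. E n l))"
    have F_meas: "range F \<subseteq> sets cantor_measure" unfolding F_def by auto
    have "incseq F" unfolding F_def by (intro monoI Un_mono order_refl UN_mono) auto
    from cantor.finite_Lim_measure_incseq[OF F_meas this]
    have lim: "(\<lambda>L. \<mu> (F L)) \<longlonglongrightarrow> \<mu> (W n)" unfolding W_eq F_def .
    (* Pads of different levels need not increase with the level, but they are nested. *)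
    have chain: "\<exists>l\<le>L. (\<Union>l\<le>L. E n l) = E n l" for L
    proof (induction L)
      case (Suc L)
      then obtain l where l: "l \<le> L" "(\<Union>l\<le>L. E n l) = E n l" by blast
      have "E n l \<subseteq> E n (Suc L) \<or> E n (Suc L) \<subseteq> E n l"
        using pad[of n l] pad[of n "Suc L"] init_seg_chain by metis
      moreover have "(\<Union>l\<le>Suc L. E n l) = E n l \<union> E n (Suc L)"
        using l(2) by (simp add: atMost_Suc Un_commute)
      ultimately show ?case using l(1) by (metis Un_absorb1 Un_absorb2 le_Suc_eq)
    qed simp
    have upper: "\<mu> (F L) \<le> (1/2) ^ n" for L
      using chain[of L] E_upper unfolding F_def by auto
    have lower: "(1/2) ^ n - 2 * (1/2) ^ L \<le> \<mu> (F L)" for L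
    proof -
      have "\<mu> (V (Suc n) \<union> E n L) \<le> \<mu> (F L)"
        unfolding F_def by (intro cantor.finite_measure_mono) auto
      then show ?thesis using E_lower[of n L] by linarith
    qed
    have "(\<lambda>L. (1/2) ^ n - 2 * (1/2) ^ L) \<longlonglongrightarrow> (1/2) ^ n - 2 * (0 :: real)"
      by (intro tendsto_intros LIMSEQ_power_zero) auto
    then have *: "(\<lambda>L. (1/2) ^ n - 2 * (1/2) ^ L) \<longlonglongrightarrow> (1/2 :: real) ^ n" by simp
    have "(\<lambda>L. \<mu> (F L)) \<longlonglongrightarrow> (1/2) ^ n"
      by (rule tendsto_sandwich[OF _ _ * tendsto_const]) (intro always_eventually allI lower upper)+
    then show ?thesis using lim LIMSEQ_unique by blast
  qed

  have "decseq W"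
  proof (rule decseq_SucI)
    fix n
    have "V (Suc (Suc n)) \<subseteq> V (Suc n)"
      unfolding V_eq using monoD[OF mono, of "Suc n" "Suc (Suc n)"] by (intro UN_mono) auto
    moreover have "E (Suc n) l \<subseteq> E n l" for l
    proof -
      have "room n l i" if room: "room (Suc n) l i" for i
      proof -
        have "\<mu> (B n l \<union> init_seg l i) \<le> \<mu> (V (Suc n) \<union> init_seg l i)"
          using V_B(2)[of n l] by (intro cantor.finite_measure_mono) auto
        also have "\<dots> \<le> \<mu> (V (Suc n)) + \<mu> (init_seg l i)"
          by (intro measure_Un_le) auto
        also have "\<mu> (init_seg l i) \<le> \<mu> (B (Suc n) l \<union> init_seg l i)"
          by (intro cantor.finite_measure_mono) auto
        finally show ?thesis using room mV[of "Suc n"] unfolding room_def by simp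
      qed
      then show ?thesis unfolding E_def by blast
    qed
    ultimately show "W (Suc n) \<subseteq> W n" unfolding W_eq by blast
  qed
  then have "schnorr_test_in A W" unfolding schnorr_test_in_def using ce measure_W by blast
  moreover have "C m \<subseteq> W n" if "N (Suc n) \<le> m" for n m
    unfolding W_eq V_eq using that by auto
  ultimately show ?thesis by blast
qed

lemma ex_schnorr_test:
  assumes C: "clopen_in A C" and N: "computable_in A N"
    and tail: "\<And>j. \<mu> (\<Union>t. C (t + N j)) \<le> (1/2) ^ j"
  obtains W where "schnorr_test_in A W" "\<And>n. \<exists>M. \<forall>m\<ge>M. C m \<subseteq> W n"
proof -
  (* Partial sums turn the modulus into a monotone one, so that the tails decrease. *)
  define N' where "N' = (\<lambda>j. \<Sum>i<Suc j. N i)"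
  have "computable_in A N'"
    unfolding N'_def by (intro comp_intros computable_compose[OF N])
  moreover have "mono N'"
    unfolding N'_def by (intro monoI sum_mono2) auto
  moreover have "\<mu> (\<Union>t. C (t + N' j)) \<le> (1/2) ^ j" for j
  proof -
    have "N j \<le> N' j" unfolding N'_def by simp
    then have "(\<Union>t. C (t + N' j)) \<subseteq> (\<Union>t. C (t + N j))"
      unfolding UN_shift by (intro UN_mono) auto
    then have "\<mu> (\<Union>t. C (t + N' j)) \<le> \<mu> (\<Union>t. C (t + N j))"
      using clopen_measurable[OF C] by (intro cantor.finite_measure_mono) auto
    then show ?thesis using tail[of j] by linarith
  qed
  ultimately show ?thesis using ex_schnorr_test_aux[OF C, of N'] that by blast
qed

lemma measure_tail_le:
  assumes "\<And>m. C m \<in> sets cantor_measure" "\<And>m. \<mu> (C m) \<le> h m" "summable h"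
  shows "\<mu> (\<Union>t. C (t + N)) \<le> (\<Sum>t. h (t + N))"
proof -
  have h: "summable (\<lambda>t. h (t + N))" using assms(3) by (simp add: summable_iff_shift)
  have sm: "summable (\<lambda>t. \<mu> (C (t + N)))"
    by (rule summable_comparison_test'[OF h]) (use assms(2) in auto)
  have "\<mu> (\<Union>t. C (t + N)) \<le> (\<Sum>t. \<mu> (C (t + N)))"
    using assms(1) sm by (intro cantor.finite_measure_subadditive_countably) auto
  also have "\<dots> \<le> (\<Sum>t. h (t + N))" using assms(2) sm h by (intro suminf_le)
  finally show ?thesis .
qed

section \<open>Dominated test weights give lowness\<close>

definition dominated :: "(nat \<Rightarrow> real) \<Rightarrow> bool" where
  "dominated f \<longleftrightarrow> (\<exists>g :: nat \<Rightarrow> real.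
     (\<forall>n. 0 \<le> g n) \<and> computable_realfun_in no_oracle g \<and>
     summable g \<and> computable_real_in no_oracle (\<Sum>n. g n) \<and> f \<le> g)"

text \<open>Stage \<open>l\<close> takes the strings enumerated before \<open>l\<close>, postponing those that are longer than \<open>l\<close>. Then
  stage \<open>l\<close> depends on \<open>l\<close> bits, and whether a string of length \<open>l\<close> enters at stage \<open>l\<close> is decidable.\<close>

lemma uniformly_ce_stages:
  assumes "uniformly_ce_open_in A U"
  obtains G where "clopen_in A (\<lambda>z. G (pfst z) (psnd z))" "\<And>n l. depends_below l (G n l)"
    "\<And>n. G n 0 = {}" "\<And>n l. G n l \<subseteq> G n (Suc l)" "\<And>n. U n = (\<Union>l. G n l)"
proof -
  obtain e where e: "computable2_in A e"
    and U: "\<And>n. U n = (\<Union>s\<in>{s. \<exists>t. e n t = Suc s}. cylinder (bin_string s))"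
    using assms unfolding uniformly_ce_open_in_def by blast
  define G where "G = (\<lambda>n l. \<Union>t<l. {X. e n t \<noteq> 0 \<and> len (e n t - 1) \<le> l}
    \<inter> cylinder (bin_string (e n t - 1)))"
  have in_G: "X \<in> G n l \<longleftrightarrow> (\<exists>t<l. \<exists>s. e n t = Suc s \<and> len s \<le> l \<and> X \<in> cylinder (bin_string s))"
    for X n l
  proof -
    have "X \<in> G n l \<longleftrightarrow> (\<exists>t<l. (e n t \<noteq> 0 \<and> len (e n t - 1) \<le> l) \<and> X \<in> cylinder (bin_string (e n t - 1)))"
      unfolding G_def by blast
    moreover have "((e n t \<noteq> 0 \<and> len (e n t - 1) \<le> l) \<and> X \<in> cylinder (bin_string (e n t - 1))) \<longleftrightarrow>
      (\<exists>s. e n t = Suc s \<and> len s \<le> l \<and> X \<in> cylinder (bin_string s))" for t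
      by (cases "e n t") auto
    ultimately show ?thesis by simp
  qed
  have e': "computable_in A (\<lambda>z. e (g z) (h z))" if "computable_in A g" "computable_in A h" for g h
    using computable_compose[OF e[unfolded computable2_iff] computable_pair[OF that]] by simp
  show ?thesis
  proof
    show "clopen_in A (\<lambda>z. G (pfst z) (psnd z))"
      unfolding G_def by (intro comp_intros e')
    show "depends_below l (G n l)" for n l
    proof -
      have "depends_below l (cylinder (bin_string s))" if "len s \<le> l" for s
        using depends_below_cylinder that by (rule depends_below_mono)
      then show ?thesis unfolding depends_below_def in_G by blast
    qed
    show "G n 0 = {}" for n using in_G by auto
    show "G n l \<subseteq> G n (Suc l)" for n l
      unfolding subset_iff in_G by (meson le_SucI less_SucI)
    show "U n = (\<Union>l. G n l)" for n
    proof (intro set_eqI iffI)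
      fix X assume "X \<in> U n"
      then obtain s t where "e n t = Suc s" "X \<in> cylinder (bin_string s)" unfolding U by blast
      then have "X \<in> G n (Suc (t + len s))" unfolding in_G by (intro exI[of _ t] conjI exI[of _ s]) auto
      then show "X \<in> (\<Union>l. G n l)" by blast
    next
      fix X assume "X \<in> (\<Union>l. G n l)"
      then show "X \<in> U n" unfolding U UN_iff in_G by blast
    qed
  qed
qed

text \<open>A point of \<open>U n\<close> enters the stages of \<open>U n\<close> at a unique length \<open>l\<close>. The relation \<open>S n s\<close> says that the
  points extending \<open>s\<close> enter \<open>U n\<close> at the length of \<open>s\<close>; so the cylinders of these strings partition
  \<open>U n\<close>, and \<open>S n\<close> is decidable although \<open>U n\<close> is only c.e. The weight of \<open>s\<close> is its measure times
  the number of \<open>n\<close> with \<open>S n s\<close>. Only \<open>n \<le> len s\<close> can occur, because a cylinder inside \<open>U n\<close>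
  cannot have measure above that of \<open>U n\<close>; this makes the weight an exact dyadic rational, and it
  makes the strings that witness membership in all components arbitrarily long.\<close>

lemma schnorr_weights:
  assumes U: "schnorr_test_in A U"
  obtains f where "dyadic_in A f" "f sums 2"
    "\<And>X n. X \<in> U n \<Longrightarrow> \<exists>s. n \<le> len s \<and> X \<in> cylinder (bin_string s) \<and> (1/2) ^ len s \<le> f s"
proof -
  obtain G where G: "clopen_in A (\<lambda>z. G (pfst z) (psnd z))" "\<And>n l. depends_below l (G n l)"
    "\<And>n. G n 0 = {}" "\<And>n l. G n l \<subseteq> G n (Suc l)" "\<And>n. U n = (\<Union>l. G n l)"
    using uniformly_ce_stages[of A U] U unfolding schnorr_test_in_def by blast
  have G_mono: "G n k \<subseteq> G n l" if "k \<le> l" for n k l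
    using lift_Suc_mono_le[of "G n" k l] G(4) that by blast
  define new where "new = (\<lambda>n l. G n l - G n (l - 1))"
  have new_dep: "depends_below l (new n l)" for n l
  proof -
    have "depends_below l (G n (l - 1))" by (rule depends_below_mono[OF G(2)]) simp
    from depends_belowD[OF G(2)[of l n]] depends_belowD[OF this] show ?thesis
      unfolding new_def depends_below_def Diff_iff by metis
  qed
  define S where "S = (\<lambda>n s. bit (Suc s) \<in> new n (len s))"
  have S_cyl: "X \<in> new n (len s) \<longleftrightarrow> S n s" if "X \<in> cylinder (bin_string s)" for X n s
    unfolding S_def using that by (intro depends_belowD[OF new_dep]) (simp add: cylinder_bin_string)
  define F where "F = (\<lambda>n s. if S n s then cylinder (bin_string s) else {})"

  have U_eq: "U n = (\<Union>s. F n s)" for n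
  proof (intro set_eqI iffI)
    fix X assume "X \<in> U n"
    then have ex: "\<exists>l. X \<in> G n l" unfolding G(5) by blast
    define l where "l = (LEAST l. X \<in> G n l)"
    have l: "X \<in> G n l" unfolding l_def using ex by (rule LeastI_ex)
    then have "l \<noteq> 0" using G(3) by (metis empty_iff)
    then have "X \<notin> G n (l - 1)"
      using not_less_Least[of "l - 1" "\<lambda>l. X \<in> G n l"] unfolding l_def by simp
    with l have new: "X \<in> new n l" unfolding new_def by simp
    obtain s where s: "len s = l" "X \<in> cylinder (bin_string s)" using ex_bin_string_cylinder by blast
    with new S_cyl have "S n s" by metis
    with s show "X \<in> (\<Union>s. F n s)" unfolding F_def by auto
  next
    fix X assume "X \<in> (\<Union>s. F n s)"
    then obtain s where "S n s" "X \<in> cylinder (bin_string s)"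
      unfolding F_def by (auto split: if_splits)
    then have "X \<in> new n (len s)" using S_cyl by blast
    then show "X \<in> U n" unfolding G(5) new_def by blast
  qed
  have disj: "disjoint_family (F n)" for n
  proof (unfold disjoint_family_on_def, intro ballI impI)
    fix s t :: nat assume "s \<noteq> t"
    show "F n s \<inter> F n t = {}"
    proof (rule ccontr)
      assume "F n s \<inter> F n t \<noteq> {}"
      then obtain X where X: "X \<in> cylinder (bin_string s)" "X \<in> cylinder (bin_string t)" "S n s" "S n t"
        unfolding F_def by (auto split: if_splits)
      then have new: "X \<in> new n (len s)" "X \<in> new n (len t)" using S_cyl by blast+
      have *: "\<not> k < l" if "X \<in> new n k" "X \<in> new n l" for k l
      proof
        assume "k < l"
        then have "k \<le> l - 1" by simp
        then show False using G_mono[of k "l - 1" n] that unfolding new_def by blast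
      qed
      then have "len s = len t" using new by (meson linorder_cases)
      then show False using bin_string_cylinder_unique X(1,2) \<open>s \<noteq> t\<close> by blast
    qed
  qed
  have F_meas: "F n s \<in> sets cantor_measure" for n s unfolding F_def by simp
  have mF: "\<mu> (F n s) = of_bool (S n s) * (1/2) ^ len s" for n s
    unfolding F_def by (simp add: measure_cylinder)
  have mU: "\<mu> (U n) = (1/2) ^ n" for n using U unfolding schnorr_test_in_def by blast
  have S_le: "n \<le> len s" if "S n s" for n s
  proof -
    have "F n s \<subseteq> U n" unfolding U_eq by blast
    then have "\<mu> (F n s) \<le> \<mu> (U n)"
      using F_meas by (intro cantor.finite_measure_mono) (auto simp: U_eq)
    then have "(1/2 :: real) ^ len s \<le> (1/2) ^ n" using that by (simp add: mF mU)
    then show ?thesis by (simp add: power_decreasing_iff)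
  qed

  define f where "f = (\<lambda>s. (\<Sum>n<Suc (len s). real (of_bool (S n s))) * (1/2) ^ len s)"
  have f: "dyadic_in A f"
  proof -
    have S_dec: "decidable_in A (\<lambda>z. bit (g z) \<in> G (h z) (k z))"
      if "computable_in A g" "computable_in A h" "computable_in A k" for g h k
      using decidable_bit_in_clopen[OF G(1) that(1) computable_pair[OF that(2,3)]] by simp
    show ?thesis
      unfolding f_def S_def new_def Diff_iff by (intro comp_intros S_dec)
  qed
  have f_nonneg: "0 \<le> f s" for s using f by (rule dyadic_nonneg)
  have f_eq: "ennreal (f s) = (\<Sum>n. emeasure cantor_measure (F n s))" for s
  proof -
    have "(\<Sum>n. emeasure cantor_measure (F n s)) = (\<Sum>n<Suc (len s). emeasure cantor_measure (F n s))"
    proof (rule suminf_finite)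
      fix n assume "n \<notin> {..<Suc (len s)}"
      then have "\<not> S n s" using S_le[of n s] by auto
      then show "emeasure cantor_measure (F n s) = 0" by (simp add: F_def)
    qed simp
    also have "\<dots> = (\<Sum>n<Suc (len s). ennreal (of_bool (S n s) * (1/2) ^ len s))"
      by (simp only: cantor.emeasure_eq_measure mF)
    also have "\<dots> = ennreal (\<Sum>n<Suc (len s). of_bool (S n s) * (1/2) ^ len s)"
      by (rule sum_ennreal) simp
    also have "(\<Sum>n<Suc (len s). of_bool (S n s) * (1/2) ^ len s) = f s"
      unfolding f_def by (simp only: sum_distrib_right of_nat_of_bool)
    finally show ?thesis by simp
  qed
  (* Interchanging the sums: summing over s for fixed n gives the measure of U n. *)
  have "(\<Sum>s. ennreal (f s)) = (\<Sum>s. \<Sum>n. emeasure cantor_measure (F n s))"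
    by (simp only: f_eq)
  also have "\<dots> = (\<integral>\<^sup>+ s. (\<Sum>n. emeasure cantor_measure (F n s)) \<partial>count_space UNIV)"
    by (rule nn_integral_count_space_nat[symmetric])
  also have "\<dots> = (\<Sum>n. \<integral>\<^sup>+ s. emeasure cantor_measure (F n s) \<partial>count_space UNIV)"
    by (rule nn_integral_suminf) simp
  also have "\<dots> = (\<Sum>n. \<Sum>s. emeasure cantor_measure (F n s))"
    by (simp only: nn_integral_count_space_nat)
  also have "\<dots> = (\<Sum>n. emeasure cantor_measure (U n))"
    unfolding U_eq using F_meas disj by (intro suminf_cong suminf_emeasure) auto
  also have "\<dots> = (\<Sum>n. ennreal ((1/2) ^ n))"
    by (simp only: cantor.emeasure_eq_measure mU)
  also have "\<dots> = ennreal (\<Sum>n. (1/2) ^ n)"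
    by (rule suminf_ennreal2) (auto intro: summable_geometric)
  also have "(\<Sum>n. (1/2 :: real) ^ n) = 2"
    by (subst suminf_geometric) auto
  finally have sum: "(\<Sum>s. ennreal (f s)) = ennreal 2" .
  then have "summable f"
    using f_nonneg by (intro summable_suminf_not_top) auto
  moreover from this have "ennreal (\<Sum>s. f s) = ennreal 2"
    using suminf_ennreal2[of f] f_nonneg sum by simp
  then have "(\<Sum>s. f s) = 2"
    using suminf_nonneg[OF \<open>summable f\<close> f_nonneg] by (simp del: ennreal_numeral)
  ultimately have sums: "f sums 2" using summable_sums by metis

  have hit: "\<exists>s. n \<le> len s \<and> X \<in> cylinder (bin_string s) \<and> (1/2) ^ len s \<le> f s" if X: "X \<in> U n" for X n
  proof -
    obtain s where s: "S n s" "X \<in> cylinder (bin_string s)"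
      using X unfolding U_eq F_def by (auto split: if_splits)
    have "real (of_bool (S n s)) \<le> (\<Sum>n<Suc (len s). real (of_bool (S n s)))"
      using S_le[OF s(1)] by (intro member_le_sum) auto
    then have "1 * (1/2) ^ len s \<le> f s"
      unfolding f_def using s(1) by (intro mult_right_mono) auto
    with s S_le show ?thesis by auto
  qed
  show ?thesis using that[OF f sums hit] .
qed

text \<open>A string enters the test when an approximation of \<open>g s\<close> shows that \<open>g s\<close> is at least half the
  measure of its cylinder. So the measures of the chosen cylinders are bounded by \<open>2 * g\<close>, whose tails
  are effectively small, and every string with \<open>f\<close>-weight at least its measure is chosen.\<close>

lemma dominated_imp_schnorr_cover:
  assumes "dominated f"
  obtains W where "schnorr_test_in no_oracle W"
    "\<And>X. (\<And>l. \<exists>s. l \<le> len s \<and> X \<in> cylinder (bin_string s) \<and> (1/2) ^ len s \<le> f s) \<Longrightarrow> X \<in> (\<Inter>n. W n)"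
proof -
  obtain g where nonneg: "\<And>n. 0 \<le> g n" and g: "computable_realfun_in no_oracle g"
    and sm: "summable g" and sum: "computable_real_in no_oracle (\<Sum>n. g n)" and fg: "\<And>n. f n \<le> g n"
    using assms unfolding dominated_def le_fun_def by blast
  obtain N where N: "computable_in no_oracle N" "\<And>j. (\<Sum>n. g (n + N j)) \<le> (1/2) ^ j"
    using computable_tail_modulus[OF g nonneg sm sum] by metis
  obtain q where q: "dyadic_in no_oracle (\<lambda>z. q (pfst z) (psnd z))" "\<And>n k. \<bar>g n - q n k\<bar> \<le> (1/2) ^ k"
    using dyadic_approximation[OF g nonneg] by metis
  (* The threshold is 3/4 of the measure of the cylinder and the approximation error is at most 1/4
     of it: the test succeeds for full weight and fails below half weight. *)
  define big where "big = (\<lambda>s. (1/2) ^ Suc (len s) + (1/2) ^ (len s + 2) \<le> q s (len s + 2))"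
  define C where "C = (\<lambda>s. if big s then cylinder (bin_string s) else {})"
  have q': "dyadic_in no_oracle (\<lambda>z. q (a z) (b z))"
    if "computable_in no_oracle a" "computable_in no_oracle b" for a b
    using dyadic_compose[OF q(1) computable_pair[OF that]] by simp
  have C: "clopen_in no_oracle C"
    unfolding C_def big_def by (intro clopen_restrict comp_intros q')
  have big: "(1/2) ^ len s \<le> 2 * g s" if "big s" for s
  proof -
    have "(1/2) ^ Suc (len s) \<le> g s"
      using that q(2)[of s "len s + 2"] unfolding big_def by linarith
    then show ?thesis by simp
  qed
  have C_le: "\<mu> (C s) \<le> 2 * g s" for s
    using big[of s] nonneg[of s] unfolding C_def by (simp add: measure_cylinder)
  have "\<mu> (\<Union>t. C (t + N (Suc j))) \<le> (1/2) ^ j" for j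
  proof -
    have "\<mu> (\<Union>t. C (t + N (Suc j))) \<le> (\<Sum>t. 2 * g (t + N (Suc j)))"
      using clopen_measurable[OF C] C_le sm by (intro measure_tail_le) auto
    also have "\<dots> = 2 * (\<Sum>t. g (t + N (Suc j)))"
      using sm by (intro suminf_mult) (simp add: summable_iff_shift)
    finally show ?thesis using N(2)[of "Suc j"] by simp
  qed
  moreover have "computable_in no_oracle (\<lambda>j. N (Suc j))"
    by (intro computable_compose[OF N(1)] comp_intros)
  ultimately obtain W where W: "schnorr_test_in no_oracle W" "\<And>n. \<exists>M. \<forall>m\<ge>M. C m \<subseteq> W n"
    using ex_schnorr_test[OF C, of "\<lambda>j. N (Suc j)"] by metis
  have "X \<in> W n" if X: "\<And>l. \<exists>s. l \<le> len s \<and> X \<in> cylinder (bin_string s) \<and> (1/2) ^ len s \<le> f s" for X n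
  proof -
    obtain M where M: "\<forall>m\<ge>M. C m \<subseteq> W n" using W(2) by blast
    obtain s where s: "M \<le> len s" "X \<in> cylinder (bin_string s)" "(1/2) ^ len s \<le> f s"
      using X by blast
    have "len s \<le> s"
      using len_bounds[of s] less_exp[of "len s"] by linarith
    have "(1/2) ^ len s - (1/2) ^ (len s + 2) \<le> q s (len s + 2)"
      using q(2)[of s "len s + 2"] s(3) fg[of s] by linarith
    then have "big s" unfolding big_def by (simp add: field_simps)
    then have "X \<in> C s" using s unfolding C_def by simp
    moreover have "C s \<subseteq> W n" using M s(1) \<open>len s \<le> s\<close> by (meson order_trans)
    ultimately show ?thesis by blast
  qed
  then show ?thesis using that W(1) by blast
qed

lemma SR_in_subset_SR: "SR_in A \<subseteq> SR"
  unfolding SR_def SR_in_def using schnorr_test_no_oracle by blast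

lemma Low_SR_iff: "A \<in> Low_SR \<longleftrightarrow> SR \<subseteq> SR_in A"
  unfolding Low_SR_def using SR_in_subset_SR by blast

theorem Low_SR_if_dominated:
  assumes "\<And>f. (\<And>n. 0 \<le> f n) \<Longrightarrow> computable_realfun_in A f \<Longrightarrow> summable f \<Longrightarrow>
    computable_real_in no_oracle (\<Sum>n. f n) \<Longrightarrow> dominated f"
  shows "A \<in> Low_SR"
  unfolding Low_SR_iff
proof (rule subsetI, rule ccontr)
  fix X assume X: "X \<in> SR" "X \<notin> SR_in A"
  then obtain U where U: "schnorr_test_in A U" "\<And>n. X \<in> U n"
    unfolding SR_in_def by blast
  obtain f where f: "dyadic_in A f" "f sums 2"
    "\<And>X n. X \<in> U n \<Longrightarrow> \<exists>s. n \<le> len s \<and> X \<in> cylinder (bin_string s) \<and> (1/2) ^ len s \<le> f s"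
    using schnorr_weights[OF U(1)] by metis
  have "dyadic_in no_oracle (\<lambda>_. real 2)" by (intro comp_intros)
  then have "computable_real_in no_oracle (\<Sum>n. f n)"
    unfolding computable_real_in_def using sums_unique[OF f(2)] dyadic_computable_realfun by simp
  then have "dominated f"
    using f by (intro assms dyadic_nonneg dyadic_computable_realfun sums_summable)
  then obtain W where W: "schnorr_test_in no_oracle W"
    "\<And>X. (\<And>l. \<exists>s. l \<le> len s \<and> X \<in> cylinder (bin_string s) \<and> (1/2) ^ len s \<le> f s) \<Longrightarrow> X \<in> (\<Inter>n. W n)"
    using dominated_imp_schnorr_cover by metis
  have "X \<in> (\<Inter>n. W n)" by (rule W(2)) (rule f(3)[OF U(2)])
  then show False using X(1) W(1) unfolding SR_def SR_in_def by blast
qed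

section \<open>Open sets of computable measure\<close>

text \<open>These are the sets that arise as c.e. open sets with computable measure. What is used of them is
  that they can be approximated from inside by clopen sets with a prescribed error.\<close>

definition approximable_open :: "(nat \<Rightarrow> bool) set \<Rightarrow> bool" where
  "approximable_open V \<longleftrightarrow> cantor_open V \<and>
     (\<exists>E. clopen_in no_oracle E \<and> (\<forall>j. E j \<subseteq> V \<and> \<mu> (V - E j) \<le> (1/2) ^ j))"

lemma approximable_measurable: "approximable_open V \<Longrightarrow> V \<in> sets cantor_measure"
  unfolding approximable_open_def using cantor_open_measurable by blast

lemma approximable_clopen:
  assumes "clopen_in no_oracle (\<lambda>_. C)"
  shows "approximable_open C"
  unfolding approximable_open_def using assms clopen_cantor_open[OF assms]
  by (intro conjI exI[of _ "\<lambda>_. C"]) auto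

lemma approximable_Un:
  assumes "approximable_open V" "approximable_open W"
  shows "approximable_open (V \<union> W)"
proof -
  obtain E where E: "clopen_in no_oracle E" "\<And>j. E j \<subseteq> V" "\<And>j. \<mu> (V - E j) \<le> (1/2) ^ j"
    using assms(1) unfolding approximable_open_def by blast
  obtain F where F: "clopen_in no_oracle F" "\<And>j. F j \<subseteq> W" "\<And>j. \<mu> (W - F j) \<le> (1/2) ^ j"
    using assms(2) unfolding approximable_open_def by blast
  have meas: "V \<in> sets cantor_measure" "W \<in> sets cantor_measure"
    "E j \<in> sets cantor_measure" "F j \<in> sets cantor_measure" for j
    using assms approximable_measurable clopen_measurable E(1) F(1) by blast+
  have "cantor_open (V \<union> W)"
    using assms cantor_open_Union[of "{V, W}"] unfolding approximable_open_def by auto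
  moreover have "clopen_in no_oracle (\<lambda>j. E (Suc j) \<union> F (Suc j))"
    by (intro comp_intros clopen_compose[OF E(1)] clopen_compose[OF F(1)])
  moreover have "\<mu> ((V \<union> W) - (E (Suc j) \<union> F (Suc j))) \<le> (1/2) ^ j" for j
  proof -
    have "\<mu> ((V \<union> W) - (E (Suc j) \<union> F (Suc j))) \<le> \<mu> ((V - E (Suc j)) \<union> (W - F (Suc j)))"
      by (rule cantor.finite_measure_mono) (use meas in blast)+
    also have "\<dots> \<le> \<mu> (V - E (Suc j)) + \<mu> (W - F (Suc j))"
      by (rule measure_Un_le) (use meas in blast)+
    also have "\<dots> \<le> (1/2) ^ Suc j + (1/2) ^ Suc j" by (intro add_mono E F)
    finally show ?thesis by simp
  qed
  ultimately show ?thesis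
    unfolding approximable_open_def using E(2) F(2)
    by (intro conjI exI[of _ "\<lambda>j. E (Suc j) \<union> F (Suc j)"]) blast+
qed

lemma schnorr_test_cantor_open:
  assumes "schnorr_test_in A U"
  shows "cantor_open (U n)"
proof -
  have "uniformly_ce_open_in A U" using assms unfolding schnorr_test_in_def by blast
  then show ?thesis
  proof (rule uniformly_ce_stages)
    fix G assume G: "\<And>n l. depends_below l (G n l)" "\<And>n. U n = (\<Union>l. G n l)"
    have "cantor_open (G n l)" for l using G(1) by (rule depends_below_cantor_open)
    then show "cantor_open (U n)" unfolding G(2) by (intro cantor_open_Union) blast
  qed
qed

text \<open>As the measure of the component is known, one can wait until all but a small part of it has been
  enumerated.\<close>

lemma approximable_schnorr_test:
  assumes U: "schnorr_test_in no_oracle U"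
  shows "approximable_open (U k)"
proof -
  obtain G where G: "clopen_in no_oracle (\<lambda>z. G (pfst z) (psnd z))" "\<And>n l. depends_below l (G n l)"
    "\<And>n. G n 0 = {}" "\<And>n l. G n l \<subseteq> G n (Suc l)" "\<And>n. U n = (\<Union>l. G n l)"
    using uniformly_ce_stages[of no_oracle U] U unfolding schnorr_test_in_def by blast
  have mU: "\<mu> (U k) = (1/2) ^ k" using U unfolding schnorr_test_in_def by blast
  have U_meas: "U k \<in> sets cantor_measure"
    using schnorr_test_cantor_open[OF U] by (rule cantor_open_measurable)
  have G_meas: "G k l \<in> sets cantor_measure" for l using G(2) by (rule depends_below_measurable)
  have G': "clopen_in no_oracle (\<lambda>z. G (g z) (h z))"
    if "computable_in no_oracle g" "computable_in no_oracle h" for g h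
    using clopen_compose[OF G(1) computable_pair[OF that]] by simp
  define r where "r = (\<lambda>j. LEAST l. (1/2) ^ k \<le> \<mu> (G k l) + (1/2) ^ j)"
  have ex: "\<exists>l. (1/2) ^ k \<le> \<mu> (G k l) + (1/2) ^ j" for j
  proof -
    have "incseq (G k)" using G(4) by (rule incseq_SucI)
    from cantor.finite_Lim_measure_incseq[OF _ this]
    have "(\<lambda>l. \<mu> (G k l)) \<longlonglongrightarrow> (1/2) ^ k" using G_meas mU unfolding G(5)[symmetric] by auto
    moreover have "(1/2) ^ k - (1/2) ^ j < (1/2 :: real) ^ k" by simp
    ultimately have "\<forall>\<^sub>F l in sequentially. (1/2) ^ k - (1/2) ^ j < \<mu> (G k l)"
      by (rule order_tendstoD)
    then obtain l where "(1/2) ^ k - (1/2) ^ j < \<mu> (G k l)"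
      unfolding eventually_sequentially by blast
    then show ?thesis by (intro exI[of _ l]) linarith
  qed
  have r: "computable_in no_oracle r"
    unfolding r_def
    by (rule computable_Least[OF _ ex]) (intro comp_intros dyadic_measure_clopen G')
  have "clopen_in no_oracle (\<lambda>j. G k (r j))" by (intro G' comp_intros r)
  moreover have "G k (r j) \<subseteq> U k" for j unfolding G(5) by blast
  moreover have "\<mu> (U k - G k (r j)) \<le> (1/2) ^ j" for j
  proof -
    have "(1/2) ^ k \<le> \<mu> (G k (r j)) + (1/2) ^ j" unfolding r_def using ex by (rule LeastI_ex)
    moreover have "\<mu> (U k - G k (r j)) = \<mu> (U k) - \<mu> (G k (r j))"
      using U_meas G_meas \<open>G k (r j) \<subseteq> U k\<close> by (rule cantor.finite_measure_Diff)
    ultimately show ?thesis using mU by linarith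
  qed
  ultimately show ?thesis
    unfolding approximable_open_def using schnorr_test_cantor_open[OF U] by blast
qed

section \<open>Covering one test by an open set of computable measure\<close>

text \<open>Compactness of Cantor space, by Tychonoff's theorem for the two-point discrete space.\<close>

lemma cantor_compact:
  assumes "incseq V" "\<And>i. cantor_open (V i)" "\<And>i. V i \<noteq> UNIV"
  shows "(\<Union>i. V i) \<noteq> UNIV"
proof
  assume cover: "(\<Union>i::nat. V i) = UNIV"
  let ?T = "product_topology (\<lambda>_::nat. discrete_topology (UNIV :: bool set)) UNIV"
  have top: "topspace ?T = UNIV" by (simp add: topspace_product_topology)
  have "compact_space ?T" by (simp add: compact_space_product_topology compact_space_discrete_topology)
  then have compact: "compactin ?T UNIV" unfolding compact_space_def top .
  have "openin ?T (V i)" for i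
    unfolding openin_product_topology_alt
  proof
    fix X assume "X \<in> V i"
    then obtain l where l: "\<And>Y. (\<forall>i<l. X i = Y i) \<Longrightarrow> Y \<in> V i"
      using assms(2) unfolding cantor_open_def by blast
    show "\<exists>U. finite {i \<in> UNIV. U i \<noteq> topspace (discrete_topology (UNIV :: bool set))} \<and>
      (\<forall>i\<in>UNIV. openin (discrete_topology UNIV) (U i)) \<and> X \<in> Pi\<^sub>E UNIV U \<and> Pi\<^sub>E UNIV U \<subseteq> V i"
    proof (intro exI[of _ "\<lambda>i. if i < l then {X i} else UNIV"] conjI)
      show "finite {i \<in> UNIV. (if i < l then {X i} else UNIV) \<noteq> topspace (discrete_topology (UNIV :: bool set))}"
        by (rule finite_subset[of _ "{..<l}"]) auto
      show "Pi\<^sub>E UNIV (\<lambda>i. if i < l then {X i} else UNIV) \<subseteq> V i"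
      proof
        fix Y assume Y: "Y \<in> Pi\<^sub>E UNIV (\<lambda>i. if i < l then {X i} else UNIV)"
        have "Y i \<in> (if i < l then {X i} else UNIV)" for i using Y by (rule PiE_mem) simp
        then show "Y \<in> V i" by (intro l) (metis singletonD)
      qed
    qed auto
  qed
  then have "\<forall>V'\<in>range V. openin ?T V'" by blast
  then obtain \<F> where "finite \<F>" "\<F> \<subseteq> range V" "UNIV \<subseteq> \<Union>\<F>"
    using compact cover unfolding compactin_def by (metis order_refl)
  then obtain I where I: "finite I" "(\<Union>i\<in>I. V i) = UNIV"
    by (metis finite_subset_image top.extremum_unique)
  obtain m where "\<forall>i\<in>I. i \<le> m" using I(1) unfolding finite_nat_set_iff_bounded_le by blast
  then have "V i \<subseteq> V m" if "i \<in> I" for i using incseqD[OF assms(1), of i m] that by blast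
  then have "(\<Union>i\<in>I. V i) \<subseteq> V m" by (rule UN_least)
  then show False using I(2) assms(3)[of m] by auto
qed

instance prog :: countable by countable_datatype

lemma countable_schnorr_tests: "countable {U. schnorr_test_in A U}"
proof -
  define E where "E = range (\<lambda>p m n. the (run A p [m, n]))"
  have "countable E" unfolding E_def by simp
  moreover have "{U. schnorr_test_in A U} \<subseteq>
    (\<lambda>e n. \<Union>s\<in>{s. \<exists>t. e n t = Suc s}. cylinder (bin_string s)) ` E"
  proof
    fix U assume "U \<in> {U. schnorr_test_in A U}"
    then obtain e where e: "computable2_in A e"
      "\<And>n. U n = (\<Union>s\<in>{s. \<exists>t. e n t = Suc s}. cylinder (bin_string s))"
      unfolding schnorr_test_in_def uniformly_ce_open_in_def by blast
    then obtain p where "\<And>m n. run A p [m, n] = Some (e m n)" unfolding computable2_in_def by blast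
    then have "e \<in> E" unfolding E_def by (intro image_eqI[of _ _ p]) auto
    then show "U \<in> (\<lambda>e n. \<Union>s\<in>{s. \<exists>t. e n t = Suc s}. cylinder (bin_string s)) ` E"
      using e(2) by (intro image_eqI[of _ _ e] ext) auto
  qed
  ultimately show ?thesis by (meson countable_image countable_subset)
qed

lemma ex_positive_cylinder:
  assumes "cantor_open W" "V \<in> sets cantor_measure" "\<mu> (W - V) \<noteq> 0"
  shows "\<exists>u. cylinder (bin_string u) \<subseteq> W \<and> 0 < \<mu> (cylinder (bin_string u) - V)"
proof (rule ccontr)
  define J where "J = {u. cylinder (bin_string u) \<subseteq> W}"
  assume "\<nexists>u. cylinder (bin_string u) \<subseteq> W \<and> 0 < \<mu> (cylinder (bin_string u) - V)"
  then have "\<not> 0 < \<mu> (cylinder (bin_string u) - V)" if "u \<in> J" for u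
    using that unfolding J_def by blast
  then have "\<mu> (cylinder (bin_string u) - V) = 0" if "u \<in> J" for u
    using that by (metis measure_nonneg order_le_less)
  then have "cylinder (bin_string u) - V \<in> null_sets cantor_measure" if "u \<in> J" for u
    using that assms(2) by (intro null_setsI) (auto simp: cantor.emeasure_eq_measure)
  then have "(\<Union>u\<in>J. cylinder (bin_string u) - V) \<in> null_sets cantor_measure"
    by (intro null_sets_UN') auto
  moreover have "(\<Union>u\<in>J. cylinder (bin_string u) - V) = W - V"
    using cantor_open_eq_cylinders[OF assms(1)] unfolding J_def by blast
  ultimately show False using assms(3) measure_eq_0_null_sets by metis
qed

lemma ex_half_power_less:
  assumes "0 < (x :: real)"
  shows "\<exists>n. (1/2) ^ n < x"
  using real_arch_pow_inv[OF assms, of "1/2"] by simp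

text \<open>A category argument. Enumerate all unrelativized Schnorr tests as \<open>T i\<close>. If no approximable open
  set of measure below \<open>1\<close> covers a component of \<open>W\<close> up to a null set, then any such set \<open>V\<close> can be
  enlarged as follows. Some cylinder in \<open>W i\<close> meets the complement of \<open>V\<close> in positive measure; adding
  the complement of that cylinder to \<open>V\<close> forces the remaining points into \<open>W i\<close>. Adding a
  sufficiently small component of \<open>T i\<close> keeps the measure below \<open>1\<close> and forces the remaining points
  to pass \<open>T i\<close>. In the limit, compactness leaves a point that is Schnorr random but not so relative
  to \<open>A\<close>.\<close>

lemma low_test_cover:
  assumes W: "schnorr_test_in A W" and low: "SR \<subseteq> SR_in A"
  shows "\<exists>n V. approximable_open V \<and> \<mu> V < 1 \<and> \<mu> (W n - V) = 0"
proof (rule ccontr)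
  assume "\<nexists>n V. approximable_open V \<and> \<mu> V < 1 \<and> \<mu> (W n - V) = 0"
  then have avoid: "\<mu> (W n - V) \<noteq> 0" if "approximable_open V" "\<mu> V < 1" for n V
    using that by blast
  define T where "T = from_nat_into {U. schnorr_test_in no_oracle U}"
  have "{U. schnorr_test_in no_oracle U} \<noteq> {}"
  proof -
    have "clopen_in no_oracle (\<lambda>_. {X. False})" by (intro comp_intros)
    from ex_schnorr_test[OF this computable_id] show ?thesis by auto
  qed
  then have T: "schnorr_test_in no_oracle (T i)" "schnorr_test_in no_oracle U \<Longrightarrow> U \<in> range T" for i U
    using from_nat_into[of "{U. schnorr_test_in no_oracle U}" i]
      range_from_nat_into[OF _ countable_schnorr_tests] unfolding T_def by auto
  have step: "\<exists>V'. (approximable_open V' \<and> \<mu> V' < 1) \<and> (V \<subseteq> V' \<and> - V' \<subseteq> W i \<and> (\<exists>k. T i k \<subseteq> V'))"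
    if V: "approximable_open V \<and> \<mu> V < 1" for V i
  proof -
    have V_meas: "V \<in> sets cantor_measure" using V approximable_measurable by blast
    obtain u where u: "cylinder (bin_string u) \<subseteq> W i" "0 < \<mu> (cylinder (bin_string u) - V)"
      using ex_positive_cylinder[OF schnorr_test_cantor_open[OF W] V_meas avoid] V by metis
    define V1 where "V1 = V \<union> - cylinder (bin_string u)"
    have V1: "approximable_open V1"
      unfolding V1_def using V
      by (intro approximable_Un[OF _ approximable_clopen] clopen_Compl clopen_cylinder computable_const)
        blast
    have "- V1 = cylinder (bin_string u) - V" unfolding V1_def by blast
    moreover have "\<mu> (- V1) = 1 - \<mu> V1"
      using cantor.prob_compl[OF approximable_measurable[OF V1]] by (simp add: Compl_eq_Diff_UNIV)
    ultimately have "0 < 1 - \<mu> V1" using u(2) by simp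
    then obtain k where k: "(1/2) ^ k < 1 - \<mu> V1" using ex_half_power_less by blast
    have Tk: "approximable_open (T i k)" using T(1) by (rule approximable_schnorr_test)
    have "\<mu> (V1 \<union> T i k) \<le> \<mu> V1 + \<mu> (T i k)"
      using V1 Tk approximable_measurable by (intro measure_Un_le) blast+
    also have "\<mu> (T i k) = (1/2) ^ k" using T(1) unfolding schnorr_test_in_def by blast
    finally have "\<mu> (V1 \<union> T i k) < 1" using k by linarith
    moreover have "approximable_open (V1 \<union> T i k)" using V1 Tk by (rule approximable_Un)
    moreover have "V \<subseteq> V1 \<union> T i k" "- (V1 \<union> T i k) \<subseteq> W i" using u(1) unfolding V1_def by auto
    ultimately show ?thesis by (intro exI[of _ "V1 \<union> T i k"]) blast
  qed
  have "approximable_open {X. False} \<and> \<mu> {X. False} < 1"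
    by (intro conjI approximable_clopen comp_intros) simp
  then have "\<exists>V. approximable_open V \<and> \<mu> V < 1" by blast
  from dependent_nat_choice[of "\<lambda>i V. approximable_open V \<and> \<mu> V < 1"
      "\<lambda>i V V'. V \<subseteq> V' \<and> - V' \<subseteq> W i \<and> (\<exists>k. T i k \<subseteq> V')", OF this step]
  obtain V where V: "\<And>i. approximable_open (V i)" "\<And>i. \<mu> (V i) < 1" "\<And>i. V i \<subseteq> V (Suc i)"
    "\<And>i. - V (Suc i) \<subseteq> W i" "\<And>i. \<exists>k. T i k \<subseteq> V (Suc i)"
    by blast
  have "(\<Union>i. V i) \<noteq> UNIV"
  proof (rule cantor_compact)
    show "incseq V" using V(3) by (rule incseq_SucI)
    show "cantor_open (V i)" for i using V(1) unfolding approximable_open_def by blast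
    show "V i \<noteq> UNIV" for i using V(2)[of i] cantor.prob_space by auto
  qed
  then obtain X where X: "\<And>i. X \<notin> V i" by blast
  have "X \<in> SR"
    unfolding SR_def SR_in_def
  proof (intro CollectI allI impI)
    fix U assume "schnorr_test_in no_oracle U"
    then obtain i where "U = T i" using T(2) by blast
    then show "X \<notin> (\<Inter>n. U n)" using V(5)[of i] X by blast
  qed
  moreover have "X \<notin> SR_in A"
    unfolding SR_in_def using W V(4) X by blast
  ultimately show False using low by blast
qed

section \<open>Independent blocks\<close>

text \<open>Starting the bits for \<open>n\<close> at the square of \<open>n\<close> keeps blocks with \<open>k \<le> n\<close> disjoint for different \<open>n\<close>.
  For the same \<open>n\<close> the blocks decrease with \<open>k\<close>.\<close>

definition block :: "nat \<Rightarrow> nat \<Rightarrow> (nat \<Rightarrow> bool) set" where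
  "block n k = {X. \<forall>i<k. X (n * n + i)}"

lemma depends_below_block: "depends_below (n * n + k) (block n k)"
  unfolding depends_below_def block_def by simp

lemma block_measurable [simp]: "block n k \<in> sets cantor_measure"
  by (rule depends_below_measurable[OF depends_below_block])

lemma clopen_block [comp_intros]:
  assumes "computable_in A n" "computable_in A k"
  shows "clopen_in A (\<lambda>e. block (n e) (k e))"
proof -
  have "clopen_in A (\<lambda>e. - (\<Union>i<k e. - {X. X (n e * n e + i)}))"
    by (intro comp_intros assms computable_compose[OF assms(1)])
  moreover have "- (\<Union>i<k e. - {X. X (n e * n e + i)}) = block (n e) (k e)" for e
    unfolding block_def by auto
  ultimately show ?thesis by simp
qed

lemma block_independent:
  assumes "depends_below l C" "l \<le> n * n"
  shows "\<mu> (C \<inter> block n k) = \<mu> C * (1/2) ^ k"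
proof -
  let ?J = "(\<lambda>i. n * n + i) ` {..<k}"
  have "block n k = {X. \<forall>i\<in>?J. X i}" unfolding block_def by auto
  moreover have "card ?J = k" by (subst card_image) (auto simp: inj_on_def)
  moreover have "\<mu> (C \<inter> {X. \<forall>i\<in>?J. X i}) = \<mu> C * (1/2) ^ card ?J"
    using assms(2) by (intro independence[OF assms(1)]) auto
  ultimately show ?thesis by simp
qed

lemma measure_block: "\<mu> (block n k) = (1/2) ^ k"
  using block_independent[of 0 UNIV n k] cantor.prob_space by (simp add: depends_below_def)

lemma measure_avoid_blocks:
  assumes D: "depends_below l D" and "l \<le> M * M" and k: "\<And>n. k n \<le> n" and "M \<le> R"
  shows "depends_below (R * R) (D - (\<Union>n\<in>{M..<R}. block n (k n))) \<and>
    \<mu> (D - (\<Union>n\<in>{M..<R}. block n (k n))) = \<mu> D * (\<Prod>n=M..<R. 1 - (1/2) ^ k n)"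
  using \<open>M \<le> R\<close>
proof (induction R rule: dec_induct)
  case base
  then show ?case using depends_below_mono[OF D assms(2)] by simp
next
  case (step R)
  define S where "S = D - (\<Union>n\<in>{M..<R}. block n (k n))"
  have S: "depends_below (R * R) S" "\<mu> S = \<mu> D * (\<Prod>n=M..<R. 1 - (1/2) ^ k n)"
    using step.IH unfolding S_def by auto
  have eq: "D - (\<Union>n\<in>{M..<Suc R}. block n (k n)) = S - S \<inter> block R (k R)"
    using step.hyps unfolding S_def by (auto simp: atLeastLessThanSuc)
  have "depends_below (Suc R * Suc R) S" by (rule depends_below_mono[OF S(1)]) simp
  moreover have "depends_below (Suc R * Suc R) (block R (k R))"
    by (rule depends_below_mono[OF depends_below_block]) (use k[of R] in simp)
  ultimately have "depends_below (Suc R * Suc R) (S - S \<inter> block R (k R))"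
    unfolding depends_below_def Diff_iff Int_iff by metis
  moreover have "\<mu> (S - S \<inter> block R (k R)) = \<mu> S - \<mu> (S \<inter> block R (k R))"
    using depends_below_measurable[OF S(1)] by (intro cantor.finite_measure_Diff) auto
  moreover have "\<mu> (S \<inter> block R (k R)) = \<mu> S * (1/2) ^ k R"
    by (rule block_independent[OF S(1)]) simp
  ultimately show ?case
    using step.hyps unfolding eq S(2) by (simp add: algebra_simps)
qed

text \<open>If the probability of avoiding all of several independent events is close to \<open>1\<close>, then the sum of
  their probabilities is small.\<close>

lemma prod_one_minus_sum:
  assumes "finite I" "\<And>i. i \<in> I \<Longrightarrow> 0 \<le> x i \<and> x i \<le> (1::real)"
  shows "(\<Prod>i\<in>I. 1 - x i) * (1 + (\<Sum>i\<in>I. x i)) \<le> 1"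
  using assms
proof (induction I rule: finite_induct)
  case (insert i I)
  define P where "P = (\<Prod>i\<in>I. 1 - x i)"
  define S where "S = (\<Sum>i\<in>I. x i)"
  have "0 \<le> P" unfolding P_def using insert by (intro prod_nonneg) auto
  moreover have "0 \<le> S" unfolding S_def using insert by (intro sum_nonneg) auto
  ultimately have "0 \<le> P * (x i * (S + x i))" using insert by auto
  moreover have "P * (1 + S) \<le> 1" unfolding P_def S_def using insert by auto
  moreover have "(1 - x i) * P * (1 + (x i + S)) = P * (1 + S) - P * (x i * (S + x i))"
    by (simp add: algebra_simps)
  ultimately have "(1 - x i) * P * (1 + (x i + S)) \<le> 1" by linarith
  then show ?case using insert unfolding P_def S_def by simp
qed simp

section \<open>Lowness gives domination\<close>

text \<open>Exponents are bounded by \<open>n\<close>, so that the block of \<open>n\<close> fits between consecutive squares; the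
  error term pays for that, and for the rounding of \<open>f n\<close> to a rational. A power of \<open>1/2\<close>
  cannot exceed \<open>1\<close>, so the lower bound is confined to arguments where the rational upper bound of
  \<open>f n\<close> is at most \<open>1\<close>.\<close>

lemma ex_dyadic_exponent:
  assumes f: "computable_realfun_in A f" and nonneg: "\<And>n. 0 \<le> f n"
  obtains k where "computable_in A k" "\<And>n. k n \<le> n" "\<And>n. (1/2) ^ k n \<le> 2 * f n + 5 * (1/2) ^ n"
    "\<And>n. 2 \<le> n \<Longrightarrow> f n \<le> 1/2 \<Longrightarrow> f n \<le> (1/2) ^ k n"
proof -
  obtain q where q: "dyadic_in A (\<lambda>z. q (pfst z) (psnd z))" "\<And>n k. \<bar>f n - q n k\<bar> \<le> (1/2) ^ k"
    using dyadic_approximation[OF f nonneg] by metis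
  (* A dyadic upper bound of f. *)
  define r where "r = (\<lambda>n. q n n + (1/2) ^ n)"
  have "dyadic_in A (\<lambda>n. q n n)"
    using dyadic_compose[OF q(1) computable_pair[OF computable_id computable_id]] by simp
  then have r: "dyadic_in A r" unfolding r_def by (intro comp_intros)
  have f_r: "f n \<le> r n" "r n \<le> f n + 2 * (1/2) ^ n" for n
    using q(2)[of n n] unfolding r_def by linarith+
  define k where "k = (\<lambda>n. LEAST k. k = n \<or> \<not> r n \<le> (1/2) ^ Suc k)"
  have k: "k n = n \<or> \<not> r n \<le> (1/2) ^ Suc (k n)" for n
    unfolding k_def by (rule LeastI[of _ n]) simp
  have k_min: "r n \<le> (1/2) ^ Suc j" if "j < k n" for n j
    using not_less_Least[OF that[unfolded k_def]] by simp
  show ?thesis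
  proof
    show "computable_in A k"
      unfolding k_def
    proof (rule computable_Least)
      show "decidable_in A (\<lambda>z. pfst z = psnd z \<or> \<not> r (psnd z) \<le> (1/2) ^ Suc (pfst z))"
        by (intro comp_intros dyadic_compose[OF r])
    qed blast
    show "k n \<le> n" for n unfolding k_def by (rule Least_le) simp
    show "(1/2) ^ k n \<le> 2 * f n + 5 * (1/2) ^ n" for n
      using k[of n]
    proof
      assume "k n = n"
      moreover have "(1/2) ^ n \<le> 5 * (1/2 :: real) ^ n" by simp
      ultimately show ?thesis using nonneg[of n] by simp
    next
      assume "\<not> r n \<le> (1/2) ^ Suc (k n)"
      then have "(1/2) ^ k n \<le> 2 * r n" by simp
      moreover have "(0::real) \<le> (1/2) ^ n" by simp
      ultimately show ?thesis using f_r(2)[of n] by linarith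
    qed
    show "f n \<le> (1/2) ^ k n" if n: "2 \<le> n" "f n \<le> 1/2" for n
    proof (cases "k n")
      case 0
      have "(1/2 :: real) ^ n \<le> (1/2) ^ 2" using n(1) by (intro power_decreasing) auto
      then show ?thesis using n(2) 0 by (simp add: power2_eq_square)
    next
      case (Suc j)
      then show ?thesis using k_min[of j n] f_r(1)[of n] by simp
    qed
  qed
qed

text \<open>The blocks of \<open>f\<close> can be packed into an \<open>A\<close>-Schnorr test. Every component of the test contains all
  but finitely many of them, so it does not matter which component is covered by \<open>V\<close>.\<close>

lemma low_block_cover:
  fixes f :: "nat \<Rightarrow> real"
  assumes low: "SR \<subseteq> SR_in A" and k: "computable_in A k"
    and k_le: "\<And>n. (1/2) ^ k n \<le> 2 * f n + 5 * (1/2) ^ n"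
    and f: "summable f" "computable_in A N" "\<And>j. (\<Sum>n. f (n + N j)) \<le> (1/2) ^ j"
    and nonneg: "\<And>n. 0 \<le> f n"
  obtains V M where "approximable_open V" "\<mu> V < 1" "\<And>n. M \<le> n \<Longrightarrow> \<mu> (block n (k n) - V) = 0"
proof -
  have C: "clopen_in A (\<lambda>n. block n (k n))" using k by (intro comp_intros)
  (* The tails of 2 * f and of 5 / 2 ^ n contribute 2 / 2 ^ (j + 2) and 10 / 2 ^ (j + 5). *)
  define N' where "N' = (\<lambda>j. N (j + 2) + (j + 5))"
  have N': "computable_in A N'"
    unfolding N'_def by (intro comp_intros computable_compose[OF f(2)])
  have "\<mu> (\<Union>t. block (t + N' j) (k (t + N' j))) \<le> (1/2) ^ j" for j
  proof -
    have geo: "(\<lambda>n. 5 * (1/2 :: real) ^ n) sums 10"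
      using sums_mult[OF geometric_sums[of "1/2 :: real"], of 5] by simp
    have geo': "summable (\<lambda>n. (1/2 :: real) ^ n)" by (simp add: summable_geometric)
    have sm: "summable (\<lambda>n. 2 * f n + 5 * (1/2) ^ n)"
      using f(1) geo' by (intro summable_add summable_mult)
    have "\<mu> (\<Union>t. block (t + N' j) (k (t + N' j))) \<le> (\<Sum>t. 2 * f (t + N' j) + 5 * (1/2) ^ (t + N' j))"
      using k_le sm by (intro measure_tail_le[where C = "\<lambda>n. block n (k n)"]) (auto simp: measure_block)
    also have "\<dots> = 2 * (\<Sum>t. f (t + N' j)) + (\<Sum>t. 5 * (1/2) ^ (t + N' j))"
      using f(1) geo' by (subst suminf_add[symmetric])
        (auto simp: suminf_mult summable_iff_shift[of f] summable_iff_shift[of "\<lambda>n. (1/2) ^ n"] intro!: summable_mult)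
    also have "(\<Sum>t. 5 * (1/2 :: real) ^ (t + N' j)) = 10 * (1/2) ^ N' j"
      using sums_mult2[OF geo, of "(1/2) ^ N' j"] by (simp add: power_add mult.assoc sums_iff)
    also have "10 * (1/2 :: real) ^ N' j \<le> 10 * (1/2) ^ (j + 5)"
      unfolding N'_def by (intro mult_left_mono power_decreasing) auto
    also have "(\<Sum>t. f (t + N' j)) \<le> (1/2) ^ (j + 2)"
    proof -
      have "summable (\<lambda>t. f (t + N (j + 2)))" using f(1) by (simp add: summable_iff_shift)
      from suminf_minus_initial_segment[OF this, of "j + 5"]
      have "(\<Sum>t. f (t + N' j)) = (\<Sum>t. f (t + N (j + 2))) - (\<Sum>t<j + 5. f (t + N (j + 2)))"
        unfolding N'_def by (simp add: algebra_simps)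
      moreover have "0 \<le> (\<Sum>t<j + 5. f (t + N (j + 2)))" by (intro sum_nonneg nonneg)
      ultimately show ?thesis using f(3)[of "j + 2"] by linarith
    qed
    finally show ?thesis by (simp add: power_add field_simps)
  qed
  then obtain W where W: "schnorr_test_in A W" "\<And>n. \<exists>M. \<forall>m\<ge>M. block m (k m) \<subseteq> W n"
    using ex_schnorr_test[OF C N'] by metis
  obtain n V where V: "approximable_open V" "\<mu> V < 1" "\<mu> (W n - V) = 0"
    using low_test_cover[OF W(1) low] by metis
  obtain M where M: "\<forall>m\<ge>M. block m (k m) \<subseteq> W n" using W(2) by blast
  have "\<mu> (block m (k m) - V) = 0" if "M \<le> m" for m
  proof -
    have "\<mu> (block m (k m) - V) \<le> \<mu> (W n - V)"
      using M that approximable_measurable[OF V(1)] cantor_open_measurable[OF schnorr_test_cantor_open[OF W(1)]]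
      by (intro cantor.finite_measure_mono) blast+
    then show ?thesis using V(3) measure_nonneg[of cantor_measure "block m (k m) - V"] by linarith
  qed
  with V show ?thesis using that by blast
qed

text \<open>The exponent \<open>h n\<close> is the least one whose block is covered by the approximation \<open>E n\<close> of \<open>V\<close> up to
  measure \<open>2\<close> to the power \<open>-n\<close>. It does not exceed \<open>k n\<close>, since the block of \<open>k n\<close> is covered by \<open>V\<close>,
  and it is computable since only clopen sets are compared.

  For the tails, let \<open>Q\<close> be the complement of \<open>V\<close> and of all chosen blocks from \<open>N0\<close> on. These blocks
  exceed \<open>V\<close> by little, so \<open>Q\<close> has positive measure. The clopen set \<open>D j\<close> contains \<open>Q\<close> and exceeds it
  by at most \<open>3\<close> times \<open>2\<close> to the power \<open>-j\<close>. Removing from \<open>D j\<close> the blocks that lie beyond the bits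
  on which \<open>D j\<close> depends still leaves a superset of \<open>Q\<close>, but by independence it
  multiplies the measure of \<open>D j\<close> by the product of the numbers \<open>1 - (1/2) ^ h n\<close>. So this product is
  close to \<open>1\<close>, and the sum of the measures of these blocks is small, with a bound computable from \<open>j\<close>.\<close>

lemma block_cover_extraction:
  assumes V: "approximable_open V" "\<mu> V < 1"
    and k: "\<And>n. k n \<le> n" "\<And>n. M \<le> n \<Longrightarrow> \<mu> (block n (k n) - V) = 0"
  obtains h N where "computable_in no_oracle h" "\<And>n. M \<le> n \<Longrightarrow> h n \<le> k n"
    "computable_in no_oracle N" "\<And>i R. (\<Sum>n=N i..<R. (1/2) ^ h n) \<le> (1/2 :: real) ^ i"
proof -
  obtain E where E: "clopen_in no_oracle E" "\<And>j. E j \<subseteq> V" "\<And>j. \<mu> (V - E j) \<le> (1/2) ^ j"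
    using V(1) unfolding approximable_open_def by blast
  have V_meas: "V \<in> sets cantor_measure" using V(1) by (rule approximable_measurable)
  have E_meas: "E j \<in> sets cantor_measure" for j using E(1) by (rule clopen_measurable)
  define h where "h = (\<lambda>n. LEAST k. k = n \<or> \<mu> (block n k - E n) \<le> (1/2) ^ n)"
  have h: "computable_in no_oracle h"
    unfolding h_def
  proof (rule computable_Least)
    show "decidable_in no_oracle
        (\<lambda>z. pfst z = psnd z \<or> \<mu> (block (psnd z) (pfst z) - E (psnd z)) \<le> (1/2) ^ psnd z)"
      by (intro comp_intros dyadic_measure_clopen clopen_compose[OF E(1)])
  qed blast
  have h_cases: "h n = n \<or> \<mu> (block n (h n) - E n) \<le> (1/2) ^ n" for n
    unfolding h_def by (rule LeastI[of _ n]) simp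
  have h_le: "h n \<le> n" for n unfolding h_def by (rule Least_le) simp
  have h_k: "h n \<le> k n" if "M \<le> n" for n
  proof -
    have "\<mu> (block n (k n) - E n) \<le> \<mu> ((block n (k n) - V) \<union> (V - E n))"
      by (rule cantor.finite_measure_mono) (use V_meas E_meas block_measurable in blast)+
    also have "\<dots> \<le> \<mu> (block n (k n) - V) + \<mu> (V - E n)"
      by (rule measure_Un_le) (use V_meas E_meas block_measurable in blast)+
    finally have "\<mu> (block n (k n) - E n) \<le> (1/2) ^ n" using k(2)[OF that] E(3)[of n] by linarith
    then show ?thesis unfolding h_def by (intro Least_le) simp
  qed
  define Z where "Z = (\<lambda>n. if M \<le> n then block n (h n) - V else {})"
  have Z_meas: "Z n \<in> sets cantor_measure" for n
    unfolding Z_def using V_meas by auto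
  have Z_le: "\<mu> (Z n) \<le> (1/2) ^ n" for n
  proof (cases "M \<le> n")
    case True
    from h_cases[of n] show ?thesis
    proof
      (* The default value is forced to coincide with k n, whose block is covered. *)
      assume "h n = n"
      then have "h n = k n" using h_k[OF True] k(1)[of n] by simp
      then show ?thesis using k(2)[OF True] True unfolding Z_def by simp
    next
      assume le: "\<mu> (block n (h n) - E n) \<le> (1/2) ^ n"
      have "\<mu> (block n (h n) - V) \<le> \<mu> (block n (h n) - E n)"
        by (rule cantor.finite_measure_mono) (use E(2) E_meas block_measurable in blast)+
      then show ?thesis using le True unfolding Z_def by simp
    qed
  qed (simp add: Z_def)
  have Z_tail: "\<mu> (\<Union>t. Z (t + p)) \<le> 2 * (1/2) ^ p" for p
  proof -
    have "\<mu> (\<Union>t. Z (t + p)) \<le> (\<Sum>t. (1/2) ^ (t + p))"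
      using Z_meas Z_le by (intro measure_tail_le) (auto simp: summable_geometric)
    also have "\<dots> = 2 * (1/2) ^ p"
      using sums_mult2[OF geometric_sums[of "1/2 :: real"], of "(1/2) ^ p"]
      by (simp add: power_add sums_iff)
    finally show ?thesis .
  qed

  define c where "c = 1 - \<mu> V"
  have "0 < c" using V(2) unfolding c_def by simp
  then obtain d where d: "(1/2) ^ d < c" using ex_half_power_less by blast
  (* From N0 on, the errors of the blocks add up to at most half of the measure c missing from V. *)
  define N0 where "N0 = M + d + 2"
  define Q where "Q = - (V \<union> (\<Union>t. Z (t + N0)))"
  have UZ_meas: "(\<Union>t. Z (t + p)) \<in> sets cantor_measure" for p using Z_meas by blast
  have Q_meas: "Q \<in> sets cantor_measure"
    unfolding Q_def Compl_eq_Diff_UNIV using V_meas UZ_meas[of N0] sets.top[of cantor_measure] by auto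
  have Q_ge: "c / 2 \<le> \<mu> Q"
  proof -
    have "\<mu> Q = 1 - \<mu> (V \<union> (\<Union>t. Z (t + N0)))"
      using cantor.prob_compl[OF sets.Un[OF V_meas UZ_meas[of N0]]] unfolding Q_def
      by (simp add: Compl_eq_Diff_UNIV)
    moreover have "\<mu> (V \<union> (\<Union>t. Z (t + N0))) \<le> \<mu> V + \<mu> (\<Union>t. Z (t + N0))"
      by (rule measure_Un_le[OF V_meas UZ_meas])
    moreover have "(1/2 :: real) ^ N0 \<le> (1/2) ^ d / 4"
    proof -
      have "(1/2 :: real) ^ N0 \<le> (1/2) ^ (d + 2)"
        unfolding N0_def by (intro power_decreasing) auto
      then show ?thesis by (simp add: power_add)
    qed
    moreover have "x < 1 - v \<Longrightarrow> a = 1 - b \<Longrightarrow> b \<le> v + z \<Longrightarrow> n \<le> x / 4 \<Longrightarrow> z \<le> 2 * n \<Longrightarrow> (1 - v) / 2 \<le> a"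
      for x v a b z n :: real by (simp add: field_simps)
    ultimately show ?thesis using Z_tail[of N0] d unfolding c_def by blast
  qed

  define D where "D = (\<lambda>j. - (E j \<union> (\<Union>n<j. {X. N0 \<le> n} \<inter> block n (h n))))"
  have "clopen_in no_oracle D"
    unfolding D_def by (intro comp_intros E(1) computable_compose[OF h])
  then obtain l where l: "computable_in no_oracle l" "\<And>j. depends_below (l j) (D j)"
    unfolding clopen_in_def by blast
  have in_D: "X \<in> D j \<longleftrightarrow> X \<notin> E j \<and> (\<forall>n<j. N0 \<le> n \<longrightarrow> X \<notin> block n (h n))" for X j
    unfolding D_def by (auto split: if_splits)
  have in_Q: "X \<in> Q \<longleftrightarrow> X \<notin> V \<and> (\<forall>n\<ge>N0. X \<notin> block n (h n))" for X
  proof -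
    have "X \<in> Q \<longleftrightarrow> X \<notin> V \<and> (\<forall>n\<ge>N0. X \<notin> Z n)"
      unfolding Q_def UN_shift[of Z] by blast
    moreover have "Z n = block n (h n) - V" if "N0 \<le> n" for n
      using that unfolding Z_def N0_def by simp
    ultimately show ?thesis by blast
  qed
  have D_meas: "D j \<in> sets cantor_measure" for j using l(2) by (rule depends_below_measurable)
  have Q_D: "Q \<subseteq> D j" for j using E(2) unfolding in_Q in_D subset_iff by blast
  have D_Q: "\<mu> (D j) \<le> \<mu> Q + 3 * (1/2) ^ j" for j
  proof -
    define p where "p = max N0 j"
    have "D j \<subseteq> Q \<union> ((V - E j) \<union> (\<Union>t. Z (t + p)))"
    proof
      fix X assume X: "X \<in> D j"
      show "X \<in> Q \<union> ((V - E j) \<union> (\<Union>t. Z (t + p)))"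
      proof (cases "X \<in> Q \<or> X \<in> V")
        case True then show ?thesis using X in_D by blast
      next
        case False
        then obtain n where n: "N0 \<le> n" "X \<in> block n (h n)" "X \<notin> V" using in_Q by blast
        then have "\<not> n < j" using X in_D by blast
        then have "p \<le> n" using n(1) unfolding p_def by simp
        moreover have "X \<in> Z n" using n unfolding Z_def N0_def by simp
        ultimately show ?thesis unfolding UN_shift by blast
      qed
    qed
    then have "\<mu> (D j) \<le> \<mu> (Q \<union> ((V - E j) \<union> (\<Union>t. Z (t + p))))"
      by (rule cantor.finite_measure_mono)
        (intro sets.Un sets.Diff Q_meas V_meas E_meas UZ_meas)
    also have "\<dots> \<le> \<mu> Q + \<mu> ((V - E j) \<union> (\<Union>t. Z (t + p)))"
      by (intro measure_Un_le sets.Un sets.Diff Q_meas V_meas E_meas UZ_meas)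
    also have "\<mu> ((V - E j) \<union> (\<Union>t. Z (t + p))) \<le> \<mu> (V - E j) + \<mu> (\<Union>t. Z (t + p))"
      by (intro measure_Un_le sets.Diff V_meas E_meas UZ_meas)
    finally have "\<mu> (D j) \<le> \<mu> Q + (\<mu> (V - E j) + \<mu> (\<Union>t. Z (t + p)))" by simp
    moreover have "(1/2 :: real) ^ p \<le> (1/2) ^ j" unfolding p_def by (intro power_decreasing) auto
    ultimately show ?thesis using E(3)[of j] Z_tail[of p] by linarith
  qed

  (* The shift by d + 4 absorbs the division by the measure of D j, which is at least c / 2. Since
     the blocks of n start at the square of n, those from l j on are independent of D j. *)
  define N where "N = (\<lambda>i. let j = i + d + 4 in N0 + j + l j)"
  have "computable_in no_oracle N"
    unfolding N_def Let_def by (intro comp_intros computable_compose[OF l(1)])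
  moreover have "(\<Sum>n=N i..<R. (1/2) ^ h n) \<le> (1/2 :: real) ^ i" for i R
  proof (cases "N i \<le> R")
    case True
    define j where "j = i + d + 4"
    define P where "P = (\<Prod>n=N i..<R. 1 - (1/2 :: real) ^ h n)"
    define S where "S = (\<Sum>n=N i..<R. (1/2 :: real) ^ h n)"
    have N_ge: "N0 \<le> N i" "l j \<le> N i" unfolding N_def j_def Let_def by auto
    have "N i \<le> N i * N i" by (cases "N i") auto
    then have "l j \<le> N i * N i" using N_ge(2) by linarith
    from measure_avoid_blocks[OF l(2) this h_le True]
    have avoid: "D j - (\<Union>n\<in>{N i..<R}. block n (h n)) \<in> sets cantor_measure"
      "\<mu> (D j - (\<Union>n\<in>{N i..<R}. block n (h n))) = \<mu> (D j) * P"
      unfolding P_def using depends_below_measurable by blast+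
    have "Q \<subseteq> D j - (\<Union>n\<in>{N i..<R}. block n (h n))"
      using Q_D[of j] N_ge(1) in_Q by auto
    then have Q_P: "\<mu> Q \<le> \<mu> (D j) * P"
      unfolding avoid(2)[symmetric] using avoid(1) by (rule cantor.finite_measure_mono)
    have S_nonneg: "0 \<le> S" unfolding S_def by (intro sum_nonneg) auto
    have PS: "P * (1 + S) \<le> 1"
      unfolding P_def S_def by (rule prod_one_minus_sum) (auto intro: power_le_one)
    have "(\<mu> (D j) - 3 * (1/2) ^ j) * (1 + S) \<le> \<mu> (D j) * P * (1 + S)"
      using D_Q[of j] Q_P S_nonneg by (intro mult_right_mono) auto
    also have "\<dots> \<le> \<mu> (D j) * 1"
      unfolding mult.assoc using PS by (intro mult_left_mono) auto
    finally have "(\<mu> (D j) - 3 * (1/2) ^ j) * S \<le> 3 * (1/2) ^ j" by (simp add: algebra_simps)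
    moreover have j_le: "3 * (1/2) ^ j \<le> c / 4 * (1/2) ^ i"
    proof -
      have "3 * (1/2 :: real) ^ j = 3 / 16 * ((1/2) ^ d * (1/2) ^ i)"
        unfolding j_def by (simp add: power_add eval_nat_numeral)
      also have "\<dots> \<le> 4 / 16 * (c * (1/2) ^ i)"
        using d \<open>0 < c\<close> by (intro mult_mono) auto
      finally show ?thesis by simp
    qed
    moreover have "c / 4 * S \<le> (\<mu> (D j) - 3 * (1/2) ^ j) * S"
    proof (rule mult_right_mono[OF _ S_nonneg])
      have "c / 4 * (1/2) ^ i \<le> c / 4 * 1"
        using \<open>0 < c\<close> by (intro mult_left_mono power_le_one) auto
      moreover have "\<mu> Q \<le> \<mu> (D j)" using Q_D D_meas by (rule cantor.finite_measure_mono)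
      ultimately show "c / 4 \<le> \<mu> (D j) - 3 * (1/2) ^ j" using j_le Q_ge by linarith
    qed
    ultimately have "c / 4 * S \<le> c / 4 * (1/2) ^ i" by linarith
    then show ?thesis using \<open>0 < c\<close> unfolding S_def by (simp add: mult_le_cancel_left)
  qed simp
  ultimately show ?thesis using that h h_k by blast
qed

text \<open>The cover controls \<open>f\<close> only from some point on. The finitely many earlier values are dominated by
  a constant, which changes neither computability nor the tails.\<close>

theorem dominated_if_low:
  assumes low: "A \<in> Low_SR" and nonneg: "\<And>n. 0 \<le> f n" and f: "computable_realfun_in A f"
    and sm: "summable f" and sum: "computable_real_in A (\<Sum>n. f n)"
  shows "dominated f"
proof -
  have low': "SR \<subseteq> SR_in A" using low Low_SR_iff by blast
  obtain Nf where Nf: "computable_in A Nf" "\<And>j. (\<Sum>n. f (n + Nf j)) \<le> (1/2) ^ j"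
    using computable_tail_modulus[OF f nonneg sm sum] by metis
  obtain k where k: "computable_in A k" "\<And>n. k n \<le> n" "\<And>n. (1/2) ^ k n \<le> 2 * f n + 5 * (1/2) ^ n"
    "\<And>n. 2 \<le> n \<Longrightarrow> f n \<le> 1/2 \<Longrightarrow> f n \<le> (1/2) ^ k n"
    using ex_dyadic_exponent[OF f nonneg] by metis
  obtain V M where V: "approximable_open V" "\<mu> V < 1" "\<And>n. M \<le> n \<Longrightarrow> \<mu> (block n (k n) - V) = 0"
    using low_block_cover[OF low' k(1,3) sm Nf nonneg] by metis
  obtain h N where h: "computable_in no_oracle h" "\<And>n. M \<le> n \<Longrightarrow> h n \<le> k n"
    and N: "computable_in no_oracle N" "\<And>i R. (\<Sum>n=N i..<R. (1/2) ^ h n) \<le> (1/2 :: real) ^ i"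
    using block_cover_extraction[OF V(1,2) k(2) V(3)] by metis
  have "\<forall>\<^sub>F n in sequentially. f n < 1/2"
    using summable_LIMSEQ_zero[OF sm] by (rule order_tendstoD) simp
  then obtain M1 where M1: "\<And>n. M1 \<le> n \<Longrightarrow> f n < 1/2" unfolding eventually_sequentially by blast
  define K where "K = M + M1 + 2"
  obtain b :: nat where b: "(\<Sum>n<K. f n) \<le> real b" using real_arch_simple by blast
  define g where "g = (\<lambda>n. if n < K then real b else (1/2) ^ h n)"
  have g: "dyadic_in no_oracle g"
    unfolding g_def by (intro comp_intros h(1))
  have "(\<Sum>n=N i + K..<R. g n) \<le> (1/2) ^ i" for i R
  proof -
    have "(\<Sum>n=N i + K..<R. g n) = (\<Sum>n=N i + K..<R. (1/2) ^ h n)"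
      by (rule sum.cong) (auto simp: g_def)
    also have "\<dots> \<le> (\<Sum>n=N i..<R. (1/2) ^ h n)" by (rule sum_mono2) auto
    finally show ?thesis using N(2)[of i R] by linarith
  qed
  moreover have "computable_in no_oracle (\<lambda>i. N i + K)" using N(1) by (intro comp_intros)
  ultimately have "summable g" "computable_real_in no_oracle (\<Sum>n. g n)"
    using computable_sum_of_modulus[OF g, of "\<lambda>i. N i + K"] by blast+
  moreover have "f n \<le> g n" for n
  proof (cases "n < K")
    case True
    have "f n \<le> (\<Sum>n<K. f n)" using True nonneg by (intro member_le_sum) auto
    then show ?thesis using b True unfolding g_def by simp
  next
    case False
    then have "f n \<le> (1/2) ^ k n" using M1[of n] unfolding K_def by (intro k(4)) auto
    also have "\<dots> \<le> (1/2) ^ h n" using False h(2)[of n] unfolding K_def by (intro power_decreasing) auto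
    finally show ?thesis using False unfolding g_def by simp
  qed
  ultimately show ?thesis
    unfolding dominated_def le_fun_def using g dyadic_nonneg dyadic_computable_realfun by blast
qed

section \<open>The characterization of lowness for Schnorr randomness\<close>

theorem proposition5p1:
  fixes A :: "nat \<Rightarrow> bool"
  shows "(A \<in> Low_SR \<longleftrightarrow>
      (\<forall>f :: nat \<Rightarrow> real.
         (\<forall>n. 0 \<le> f n) \<and> computable_realfun_in A f \<and>
         summable f \<and> computable_real_in no_oracle (\<Sum>n. f n) \<longrightarrow>
         (\<exists>g :: nat \<Rightarrow> real.
            (\<forall>n. 0 \<le> g n) \<and> computable_realfun_in no_oracle g \<and>
            summable g \<and> computable_real_in no_oracle (\<Sum>n. g n) \<and> f \<le> g)))
    \<and> (A \<in> Low_SR \<longleftrightarrow>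
      (\<forall>f :: nat \<Rightarrow> real.
         (\<forall>n. 0 \<le> f n) \<and> computable_realfun_in A f \<and>
         summable f \<and> computable_real_in A (\<Sum>n. f n) \<longrightarrow>
         (\<exists>g :: nat \<Rightarrow> real.
            (\<forall>n. 0 \<le> g n) \<and> computable_realfun_in no_oracle g \<and>
            summable g \<and> computable_real_in no_oracle (\<Sum>n. g n) \<and> f \<le> g)))"
proof -
  have weaken: "computable_real_in no_oracle x \<Longrightarrow> computable_real_in A x" for x
    unfolding computable_real_in_def by (rule computable_realfun_no_oracle)
  note down = dominated_if_low[of A] and up = Low_SR_if_dominated[of A]
  show ?thesis
    unfolding dominated_def[symmetric] using weaken down up by blast
qed

end
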